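(* Up to identification of each complete lattice $(L,\le)$ with its complete context $(L,L,\le)$ (and the corresponding identification of morphisms described in the context), the following are full reflective subcategories: $$\mathbf{CLjm}\hookrightarrow\mathbf{Cjm},\quad \mathbf{CLc}\hookrightarrow\mathbf{Cc},\quad \mathbf{CLcd}\hookrightarrow\mathbf{Ccd},\quad \mathbf{CLce}\hookrightarrow\mathbf{Cce},\quad \mathbf{CLis}\hookrightarrow\mathbf{Cde},$$ $$\mathbf{CLc}_*\hookrightarrow\mathbf{Cc}^*_*,\quad \mathbf{CLc}_*\mathbf d\hookrightarrow\mathbf{Cc}^*_*\mathbf d,\quad \mathbf{CLc}_*\mathbf e\hookrightarrow\mathbf{Cc}^*_*\mathbf e,$$ and analogously, with doubly residual morphisms, $\mathbf{CLc}^*\hookrightarrow\mathbf{Cc}^*_*$, $\mathbf{CLc}^*\mathbf d\hookrightarrow\mathbf{Cc}^*_*\mathbf d$, $\mathbf{CLc}^*\mathbf e\hookrightarrow\mathbf{Cc}^*_*\mathbf e$.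
   Context: **Contexts.** A (formal) context is a triple $\mathbb K=(G,M,I)$ with sets $G,M$ and $I\subseteq G\times M$. For $A\subseteq G$, $A^{\uparrow}=\{m\in M: g\,I\,m\ \forall g\in A\}$; for $B\subseteq M$, $B^{\downarrow}=\{g\in G: g\,I\,m\ \forall m\in B\}$. Extents are the sets $A\subseteq G$ with $A=A^{\uparrow\downarrow}$, intents the sets $B\subseteq M$ with $B=B^{\downarrow\uparrow}$. A concept is a pair $(A,B)$ with $A=B^{\downarrow}$, $B=A^{\uparrow}$; $\mathcal B(\mathbb K)$ is the set of concepts. **Mapping pairs.** A mapping pair $(\alpha,\beta):\mathbb K=(G,M,I)\to\mathbb L=(H,N,J)$ consists of maps $\alpha:G\to H$, $\beta:M\to N$ (composition is componentwise). Images are written $\varphi[\cdot]$, preimages $\varphi^{-}[\cdot]$. The pair is - separately continuous if $\alpha$-preimages of extents are extents and $\beta$-preimages of intents are intents; - conceptual if it is separately continuous and $(A,B)\in\mathcal B(\mathbb K)$ implies $(\beta[B]^{\downarrow},\alpha[A]^{\uparrow})\in\mathcal B(\mathbb L)$; - concept continuous if $(C,D)\in\mathcal B(\mathbb L)$ implies $(\alpha^{-}[C],\beta^{-}[D])\in\mathcal B(\mathbb K)$; - an embedding if $g\,I\,m\iff\alpha(g)\,J\,\beta(m)$; - dense if for each $C\subseteq H$ there is $A\subseteq G$ with $C^{\uparrow\downarrow}=\alpha[A]^{\uparrow\downarrow}$ and for each $D\subseteq N$ there is $B\subseteq M$ with $D^{\downarrow\uparrow}=\beta[B]^{\downarrow\uparrow}$.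 **Categories of contexts** (objects: all contexts), with morphisms: $\mathbf{Cjm}$ separately continuous pairs; $\mathbf{Cc}$ conceptual pairs; $\mathbf{Ccd}$ dense conceptual pairs; $\mathbf{Cce}$ conceptual embeddings; $\mathbf{Cde}$ dense embeddings; $\mathbf{Cc}^*_*$ concept continuous pairs; $\mathbf{Cc}^*_*\mathbf d$ dense concept continuous pairs; $\mathbf{Cc}^*_*\mathbf e$ concept continuous embeddings. **Categories of complete lattices** (objects: all complete lattices). $\varphi^*$ denotes the upper (right) adjoint and $\varphi_*$ the lower (left) adjoint of $\varphi$ when they exist; $\varphi^{**}=(\varphi^* )^*$, $\varphi_{**}=(\varphi_* )_*$. A map is doubly residuated if it has an upper adjoint which again has an upper adjoint, and doubly residual if it has a lower adjoint which again has a lower adjoint. Complete homomorphisms preserve arbitrary joins and meets. Morphisms: $\mathbf{CLjm}$ pairs $(\varphi,\psi)$ of maps with $\varphi$ preserving arbitrary joins and $\psi$ preserving arbitrary meets; $\mathbf{CLc}$ complete homomorphisms; $\mathbf{CLcd}$ surjective complete homomorphisms; $\mathbf{CLce}$ injective complete homomorphisms; $\mathbf{CLis}$ isomorphisms; $\mathbf{CLc}_*$ (resp. $\mathbf{CLc}_*\mathbf d$, $\mathbf{CLc}_*\mathbf e$) doubly residuated maps (resp. surjective, injective ones); $\mathbf{CLc}^*$ (resp. $\mathbf{CLc}^*\mathbf d$, $\mathbf{CLc}^*\mathbf e$) doubly residual maps (resp. surjective, injective ones). **Identifications.** As context morphisms between complete contexts: a $\mathbf{CLjm}$-morphism is the same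 pair; a complete homomorphism $\varphi$ is identified with $(\varphi,\varphi)$; a doubly residuated map $\psi$ with $(\psi,\psi^{**})$; a doubly residual map $\psi$ with $(\psi_{**},\psi)$. *)

theory Defs
  imports "HOL-Algebra.Galois_Connection" "HOL-Library.FuncSet"
begin

section \<open>Contexts\<close>

record ('g, 'm) formal_context =
  objects :: "'g set"
  attributes :: "'m set"
  incidence :: "('g \<times> 'm) set"

definition is_context :: "('g, 'm) formal_context \<Rightarrow> bool" where
  "is_context K \<longleftrightarrow> incidence K \<subseteq> objects K \<times> attributes K"

definition up :: "('g, 'm) formal_context \<Rightarrow> 'g set \<Rightarrow> 'm set" where
  "up K A = {m \<in> attributes K. \<forall>g\<in>A. (g, m) \<in> incidence K}"

definition down :: "('g, 'm) formal_context \<Rightarrow> 'm set \<Rightarrow> 'g set" where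
  "down K B = {g \<in> objects K. \<forall>m\<in>B. (g, m) \<in> incidence K}"

definition extents :: "('g, 'm) formal_context \<Rightarrow> 'g set set" where
  "extents K = {A. A \<subseteq> objects K \<and> A = down K (up K A)}"

definition intents :: "('g, 'm) formal_context \<Rightarrow> 'm set set" where
  "intents K = {B. B \<subseteq> attributes K \<and> B = up K (down K B)}"

definition concepts :: "('g, 'm) formal_context \<Rightarrow> ('g set \<times> 'm set) set" where
  "concepts K = {(A, B). A = down K B \<and> B = up K A}"


section \<open>Mapping pairs\<close>

text \<open>The components of a mapping pair are extensional functions (undefined outside
  the objects, respectively the attributes, of the source), so that equality of mapping pairs is
  equality of the maps on these sets.\<close>

type_synonym ('g, 'm, 'h, 'n) map_pair = "('g \<Rightarrow> 'h) \<times> ('m \<Rightarrow> 'n)"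

definition mapping_pairs ::
  "('g, 'm) formal_context \<Rightarrow> ('h, 'n) formal_context \<Rightarrow> ('g, 'm, 'h, 'n) map_pair set" where
  "mapping_pairs K L =
     (objects K \<rightarrow>\<^sub>E objects L) \<times> (attributes K \<rightarrow>\<^sub>E attributes L)"

definition pair_id :: "('g, 'm) formal_context \<Rightarrow> ('g, 'm, 'g, 'm) map_pair" where
  "pair_id K = (restrict id (objects K), restrict id (attributes K))"

text \<open>\<open>pair_comp K q p\<close> is \<open>q\<close> after \<open>p\<close>, where \<open>K\<close> is the source of \<open>p\<close>.\<close>

definition pair_comp :: "('g, 'm) formal_context \<Rightarrow> ('h, 'n, 'i, 'o) map_pair \<Rightarrow>
    ('g, 'm, 'h, 'n) map_pair \<Rightarrow> ('g, 'm, 'i, 'o) map_pair" where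
  "pair_comp K q p =
     (compose (objects K) (fst q) (fst p), compose (attributes K) (snd q) (snd p))"

definition separately_continuous :: "('g, 'm) formal_context \<Rightarrow> ('h, 'n) formal_context \<Rightarrow>
    ('g, 'm, 'h, 'n) map_pair \<Rightarrow> bool" where
  "separately_continuous K L = (\<lambda>(\<alpha>, \<beta>).
     (\<forall>C\<in>extents L. \<alpha> -` C \<inter> objects K \<in> extents K) \<and>
     (\<forall>D\<in>intents L. \<beta> -` D \<inter> attributes K \<in> intents K))"

definition conceptual :: "('g, 'm) formal_context \<Rightarrow> ('h, 'n) formal_context \<Rightarrow>
    ('g, 'm, 'h, 'n) map_pair \<Rightarrow> bool" where
  "conceptual K L = (\<lambda>(\<alpha>, \<beta>).
     separately_continuous K L (\<alpha>, \<beta>) \<and>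
     (\<forall>(A, B)\<in>concepts K. (down L (\<beta> ` B), up L (\<alpha> ` A)) \<in> concepts L))"

definition concept_continuous :: "('g, 'm) formal_context \<Rightarrow> ('h, 'n) formal_context \<Rightarrow>
    ('g, 'm, 'h, 'n) map_pair \<Rightarrow> bool" where
  "concept_continuous K L = (\<lambda>(\<alpha>, \<beta>).
     \<forall>(C, D)\<in>concepts L. (\<alpha> -` C \<inter> objects K, \<beta> -` D \<inter> attributes K) \<in> concepts K)"

definition embedding :: "('g, 'm) formal_context \<Rightarrow> ('h, 'n) formal_context \<Rightarrow>
    ('g, 'm, 'h, 'n) map_pair \<Rightarrow> bool" where
  "embedding K L = (\<lambda>(\<alpha>, \<beta>).
     \<forall>g\<in>objects K. \<forall>m\<in>attributes K.
       (g, m) \<in> incidence K \<longleftrightarrow> (\<alpha> g, \<beta> m) \<in> incidence L)"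

definition dense_pair :: "('g, 'm) formal_context \<Rightarrow> ('h, 'n) formal_context \<Rightarrow>
    ('g, 'm, 'h, 'n) map_pair \<Rightarrow> bool" where
  "dense_pair K L = (\<lambda>(\<alpha>, \<beta>).
     (\<forall>C\<subseteq>objects L. \<exists>A\<subseteq>objects K. down L (up L C) = down L (up L (\<alpha> ` A))) \<and>
     (\<forall>D\<subseteq>attributes L. \<exists>B\<subseteq>attributes K. up L (down L D) = up L (down L (\<beta> ` B))))"


section \<open>Categories of contexts\<close>

text \<open>The categories with concept continuous morphisms, written with an upper and a lower star in
  the literature, are named \<open>Ccc\<close> (all), \<open>Cccd\<close> (dense), \<open>Ccce\<close> (embeddings).\<close>

datatype context_cat = Cjm | Cc | Ccd | Cce | Cde | Ccc | Cccd | Ccce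

fun context_mor :: "context_cat \<Rightarrow> ('g, 'm) formal_context \<Rightarrow> ('h, 'n) formal_context \<Rightarrow>
    ('g, 'm, 'h, 'n) map_pair \<Rightarrow> bool" where
  "context_mor Cjm  K L p \<longleftrightarrow> separately_continuous K L p"
| "context_mor Cc   K L p \<longleftrightarrow> conceptual K L p"
| "context_mor Ccd  K L p \<longleftrightarrow> conceptual K L p \<and> dense_pair K L p"
| "context_mor Cce  K L p \<longleftrightarrow> conceptual K L p \<and> embedding K L p"
| "context_mor Cde  K L p \<longleftrightarrow> dense_pair K L p \<and> embedding K L p"
| "context_mor Ccc  K L p \<longleftrightarrow> concept_continuous K L p"
| "context_mor Cccd K L p \<longleftrightarrow> concept_continuous K L p \<and> dense_pair K L p"
| "context_mor Ccce K L p \<longleftrightarrow> concept_continuous K L p \<and> embedding K L p"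

definition context_hom :: "context_cat \<Rightarrow> ('g, 'm) formal_context \<Rightarrow> ('h, 'n) formal_context \<Rightarrow>
    ('g, 'm, 'h, 'n) map_pair set" where
  "context_hom C K L = {p \<in> mapping_pairs K L. context_mor C K L p}"

text \<open>The objects of each of these categories are the contexts over all types. As HOL has no
  quantification over types inside formulas, each object involved comes with its own, independent
  type parameters.\<close>

definition context_category :: "context_cat \<Rightarrow>
    ('g1, 'm1) formal_context itself \<Rightarrow> ('g2, 'm2) formal_context itself \<Rightarrow>
    ('g3, 'm3) formal_context itself \<Rightarrow> ('g4, 'm4) formal_context itself \<Rightarrow> bool" where
  "context_category C T1 T2 T3 T4 \<longleftrightarrow>
     (\<forall>(K1 :: ('g1, 'm1) formal_context) (K2 :: ('g2, 'm2) formal_context)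
       (K3 :: ('g3, 'm3) formal_context) (K4 :: ('g4, 'm4) formal_context).
       is_context K1 \<and> is_context K2 \<and> is_context K3 \<and> is_context K4 \<longrightarrow>
         pair_id K1 \<in> context_hom C K1 K1 \<and>
         (\<forall>p\<in>context_hom C K1 K2.
            pair_comp K1 p (pair_id K1) = p \<and> pair_comp K1 (pair_id K2) p = p) \<and>
         (\<forall>p\<in>context_hom C K1 K2. \<forall>q\<in>context_hom C K2 K3.
            pair_comp K1 q p \<in> context_hom C K1 K3) \<and>
         (\<forall>p\<in>context_hom C K1 K2. \<forall>q\<in>context_hom C K2 K3. \<forall>r\<in>context_hom C K3 K4.
            pair_comp K1 r (pair_comp K1 q p) = pair_comp K1 (pair_comp K2 r q) p))"


section \<open>Adjoint maps and categories of complete lattices\<close>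

definition adjoint_maps :: "'x gorder \<Rightarrow> 'y gorder \<Rightarrow> ('x \<Rightarrow> 'y) \<Rightarrow> ('y \<Rightarrow> 'x) \<Rightarrow> bool" where
  "adjoint_maps L L' f g \<longleftrightarrow>
     galois_connection \<lparr> orderA = L, orderB = L', lower = f, upper = g \<rparr>"

text \<open>The upper adjoint of \<open>f : L \<rightarrow> L'\<close> and the lower adjoint of \<open>g : L \<rightarrow> L'\<close>; both are maps from
  \<open>L'\<close> to \<open>L\<close>. The Galois connection determines them on the carrier of \<open>L'\<close> only, whence the
  extensionality.\<close>

definition the_upper_adjoint :: "'x gorder \<Rightarrow> 'y gorder \<Rightarrow> ('x \<Rightarrow> 'y) \<Rightarrow> ('y \<Rightarrow> 'x)" where
  "the_upper_adjoint L L' f = (THE g. g \<in> extensional (carrier L') \<and> adjoint_maps L L' f g)"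

definition the_lower_adjoint :: "'x gorder \<Rightarrow> 'y gorder \<Rightarrow> ('x \<Rightarrow> 'y) \<Rightarrow> ('y \<Rightarrow> 'x)" where
  "the_lower_adjoint L L' g = (THE f. f \<in> extensional (carrier L') \<and> adjoint_maps L' L f g)"

definition doubly_residuated :: "'x gorder \<Rightarrow> 'y gorder \<Rightarrow> ('x \<Rightarrow> 'y) \<Rightarrow> bool" where
  "doubly_residuated L L' f \<longleftrightarrow> (\<exists>g h. adjoint_maps L L' f g \<and> adjoint_maps L' L g h)"

definition doubly_residual :: "'x gorder \<Rightarrow> 'y gorder \<Rightarrow> ('x \<Rightarrow> 'y) \<Rightarrow> bool" where
  "doubly_residual L L' f \<longleftrightarrow> (\<exists>g h. adjoint_maps L' L g f \<and> adjoint_maps L L' h g)"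

definition complete_hom :: "'x gorder \<Rightarrow> 'y gorder \<Rightarrow> ('x \<Rightarrow> 'y) \<Rightarrow> bool" where
  "complete_hom L L' f \<longleftrightarrow> sup_pres L L' f \<and> inf_pres L L' f"

text \<open>A morphism of complete lattices is a pair of maps in \<open>CLjm\<close> and a single map in all other
  categories. A lower (upper) star is rendered by the suffix \<open>low\<close> (\<open>upp\<close>): the morphisms of
  \<open>CLc_low\<close> are the doubly residuated maps, those of \<open>CLc_upp\<close> the doubly residual ones.\<close>

datatype ('x, 'y) lattice_mor = Single "'x \<Rightarrow> 'y" | Pair "'x \<Rightarrow> 'y" "'x \<Rightarrow> 'y"

datatype lattice_cat = CLjm | CLc | CLcd | CLce | CLis
  | CLc_low | CLc_low_d | CLc_low_e | CLc_upp | CLc_upp_d | CLc_upp_e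

fun single_mor :: "lattice_cat \<Rightarrow> 'x gorder \<Rightarrow> 'y gorder \<Rightarrow> ('x \<Rightarrow> 'y) \<Rightarrow> bool" where
  "single_mor CLjm L L' f \<longleftrightarrow> False"
| "single_mor CLc  L L' f \<longleftrightarrow> complete_hom L L' f"
| "single_mor CLcd L L' f \<longleftrightarrow> complete_hom L L' f \<and> f ` carrier L = carrier L'"
| "single_mor CLce L L' f \<longleftrightarrow> complete_hom L L' f \<and> inj_on f (carrier L)"
| "single_mor CLis L L' f \<longleftrightarrow> order_emb L L' f \<and> bij_betw f (carrier L) (carrier L')"
| "single_mor CLc_low   L L' f \<longleftrightarrow> doubly_residuated L L' f"
| "single_mor CLc_low_d L L' f \<longleftrightarrow> doubly_residuated L L' f \<and> f ` carrier L = carrier L'"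
| "single_mor CLc_low_e L L' f \<longleftrightarrow> doubly_residuated L L' f \<and> inj_on f (carrier L)"
| "single_mor CLc_upp   L L' f \<longleftrightarrow> doubly_residual L L' f"
| "single_mor CLc_upp_d L L' f \<longleftrightarrow> doubly_residual L L' f \<and> f ` carrier L = carrier L'"
| "single_mor CLc_upp_e L L' f \<longleftrightarrow> doubly_residual L L' f \<and> inj_on f (carrier L)"

definition lattice_hom :: "lattice_cat \<Rightarrow> 'x gorder \<Rightarrow> 'y gorder \<Rightarrow> ('x, 'y) lattice_mor set" where
  "lattice_hom D L L' =
     (if D = CLjm
      then {Pair f f' | f f'. f \<in> carrier L \<rightarrow>\<^sub>E carrier L' \<and> f' \<in> carrier L \<rightarrow>\<^sub>E carrier L' \<and>
              sup_pres L L' f \<and> inf_pres L L' f'}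
      else {Single f | f. f \<in> carrier L \<rightarrow>\<^sub>E carrier L' \<and> single_mor D L L' f})"

definition lattice_id :: "lattice_cat \<Rightarrow> 'x gorder \<Rightarrow> ('x, 'x) lattice_mor" where
  "lattice_id D L =
     (if D = CLjm then Pair (restrict id (carrier L)) (restrict id (carrier L))
      else Single (restrict id (carrier L)))"

text \<open>A \<open>Single\<close> and a \<open>Pair\<close> never occur in the same category, so the last equation
  is irrelevant.\<close>

fun lattice_comp :: "'x gorder \<Rightarrow> ('y, 'z) lattice_mor \<Rightarrow> ('x, 'y) lattice_mor \<Rightarrow>
    ('x, 'z) lattice_mor" where
  "lattice_comp L (Single g) (Single f) = Single (compose (carrier L) g f)"
| "lattice_comp L (Pair g g') (Pair f f') =
     Pair (compose (carrier L) g f) (compose (carrier L) g' f')"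
| "lattice_comp L _ _ = undefined"

definition lattice_category :: "lattice_cat \<Rightarrow>
    'x1 itself \<Rightarrow> 'x2 itself \<Rightarrow> 'x3 itself \<Rightarrow> 'x4 itself \<Rightarrow> bool" where
  "lattice_category D T1 T2 T3 T4 \<longleftrightarrow>
     (\<forall>(L1 :: 'x1 gorder) (L2 :: 'x2 gorder) (L3 :: 'x3 gorder) (L4 :: 'x4 gorder).
       complete_lattice L1 \<and> complete_lattice L2 \<and> complete_lattice L3 \<and> complete_lattice L4 \<longrightarrow>
         lattice_id D L1 \<in> lattice_hom D L1 L1 \<and>
         (\<forall>h\<in>lattice_hom D L1 L2.
            lattice_comp L1 h (lattice_id D L1) = h \<and> lattice_comp L1 (lattice_id D L2) h = h) \<and>
         (\<forall>h\<in>lattice_hom D L1 L2. \<forall>k\<in>lattice_hom D L2 L3.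
            lattice_comp L1 k h \<in> lattice_hom D L1 L3) \<and>
         (\<forall>h\<in>lattice_hom D L1 L2. \<forall>k\<in>lattice_hom D L2 L3. \<forall>l\<in>lattice_hom D L3 L4.
            lattice_comp L1 l (lattice_comp L1 k h) = lattice_comp L1 (lattice_comp L2 l k) h))"


section \<open>Complete lattices as complete contexts\<close>

definition complete_context :: "'x gorder \<Rightarrow> ('x, 'x) formal_context" where
  "complete_context L = \<lparr> objects = carrier L, attributes = carrier L,
     incidence = {(x, y) \<in> carrier L \<times> carrier L. x \<sqsubseteq>\<^bsub>L\<^esub> y} \<rparr>"

definition identify_single :: "lattice_cat \<Rightarrow> 'x gorder \<Rightarrow> 'y gorder \<Rightarrow> ('x \<Rightarrow> 'y) \<Rightarrow>
    ('x, 'x, 'y, 'y) map_pair" where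
  "identify_single D L L' f =
     (if D \<in> {CLc_low, CLc_low_d, CLc_low_e}
        then (f, the_upper_adjoint L' L (the_upper_adjoint L L' f))
      else if D \<in> {CLc_upp, CLc_upp_d, CLc_upp_e}
        then (the_lower_adjoint L' L (the_lower_adjoint L L' f), f)
      else (f, f))"

fun identify :: "lattice_cat \<Rightarrow> 'x gorder \<Rightarrow> 'y gorder \<Rightarrow> ('x, 'y) lattice_mor \<Rightarrow>
    ('x, 'x, 'y, 'y) map_pair" where
  "identify D L L' (Pair f f') = (f, f')"
| "identify D L L' (Single f) = identify_single D L L' f"

text \<open>The assignment of complete contexts to complete lattices, together with \<open>identify\<close>, is a
  functor that is injective on objects, full and faithful. Injectivity on objects can only hold up
  to the values of the order relation outside the carrier, which are junk.\<close>

definition full_subcategory :: "lattice_cat \<Rightarrow> context_cat \<Rightarrow>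
    'x1 itself \<Rightarrow> 'x2 itself \<Rightarrow> 'x3 itself \<Rightarrow> bool" where
  "full_subcategory D C T1 T2 T3 \<longleftrightarrow>
     (\<forall>(L :: 'x1 gorder) (L' :: 'x1 gorder).
       complete_lattice L \<and> complete_lattice L' \<and> complete_context L = complete_context L' \<longrightarrow>
         carrier L = carrier L' \<and>
         (\<forall>x\<in>carrier L. \<forall>y\<in>carrier L. x \<sqsubseteq>\<^bsub>L\<^esub> y \<longleftrightarrow> x \<sqsubseteq>\<^bsub>L'\<^esub> y)) \<and>
     (\<forall>(L1 :: 'x1 gorder) (L2 :: 'x2 gorder) (L3 :: 'x3 gorder).
       complete_lattice L1 \<and> complete_lattice L2 \<and> complete_lattice L3 \<longrightarrow>
         is_context (complete_context L1) \<and>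
         identify D L1 L1 (lattice_id D L1) = pair_id (complete_context L1) \<and>
         (\<forall>h\<in>lattice_hom D L1 L2. \<forall>k\<in>lattice_hom D L2 L3.
            identify D L1 L3 (lattice_comp L1 k h) =
            pair_comp (complete_context L1) (identify D L2 L3 k) (identify D L1 L2 h)) \<and>
         bij_betw (identify D L1 L2)
           (lattice_hom D L1 L2)
           (context_hom C (complete_context L1) (complete_context L2)))"


section \<open>Reflections\<close>

text \<open>\<open>(R, e)\<close> has the universal property of a reflection of \<open>K\<close>, tested against the complete
  lattices with elements in the type \<open>'x\<close>.\<close>

definition is_reflection :: "lattice_cat \<Rightarrow> context_cat \<Rightarrow> ('g, 'm) formal_context \<Rightarrow>
    'r gorder \<Rightarrow> ('g, 'm, 'r, 'r) map_pair \<Rightarrow> 'x itself \<Rightarrow> bool" where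
  "is_reflection D C K R e T \<longleftrightarrow>
     complete_lattice R \<and>
     e \<in> context_hom C K (complete_context R) \<and>
     (\<forall>L :: 'x gorder. complete_lattice L \<longrightarrow>
        (\<forall>p\<in>context_hom C K (complete_context L).
           \<exists>!h. h \<in> lattice_hom D R L \<and>
             pair_comp K (identify D R L h) e = p))"

definition concept_lattice :: "('g, 'm) formal_context \<Rightarrow> ('g set \<times> 'm set) gorder" where
  "concept_lattice K =
     \<lparr> carrier = concepts K, eq = (=), le = (\<lambda>c d. fst c \<subseteq> fst d) \<rparr>"

definition concept_unit :: "('g, 'm) formal_context \<Rightarrow>
    ('g, 'm, 'g set \<times> 'm set, 'g set \<times> 'm set) map_pair" where
  "concept_unit K =
     (\<lambda>g\<in>objects K. (down K (up K {g}), up K {g}),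
      \<lambda>m\<in>attributes K. (down K {m}, up K (down K {m})))"

text \<open>A reflection of \<open>K\<close> must have its universal property with respect to complete lattices over
  all types. This cannot be said of an existentially quantified reflection, because its witness
  might depend on the type \<open>'x\<close> of the test objects. The reflection is therefore
  named explicitly: it is the concept lattice with its canonical object and attribute maps,
  which mention neither \<open>'x\<close> nor the categories.\<close>

definition reflective :: "lattice_cat \<Rightarrow> context_cat \<Rightarrow>
    ('g, 'm) formal_context itself \<Rightarrow> 'x itself \<Rightarrow> bool" where
  "reflective D C TK TL \<longleftrightarrow>
     (\<forall>K :: ('g, 'm) formal_context. is_context K \<longrightarrow>
        is_reflection D C K (concept_lattice K) (concept_unit K) TL)"

end

theory Submission
  imports Defs
begin

text \<open>For a separately continuous pair \<open>(\<alpha>, \<beta>)\<close> from a context \<open>K\<close> to a complete lattice \<open>L\<close>, the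
  maps \<open>f (A, B) = \<Squnion> \<alpha>[A]\<close> and \<open>f' (A, B) = \<Sqinter> \<beta>[B]\<close> on the concept lattice preserve
  joins and meets, because \<open>f (A, B) \<le> y\<close> says that \<open>A\<close> is contained in the extent
  \<open>{g. \<alpha> g \<le> y}\<close>. They are the only such maps extending \<open>(\<alpha>, \<beta>)\<close> along the canonical embedding,
  as every concept is a join of object concepts and a meet of attribute concepts. Conceptuality,
  concept continuity, density and the embedding property all pass from \<open>(\<alpha>, \<beta>)\<close> to \<open>(f, f')\<close>.
  Between complete lattices a pair \<open>(f, f')\<close> is conceptual iff \<open>f = f'\<close> is a complete
  homomorphism, and it is concept continuous iff some map is both upper adjoint to \<open>f\<close> and lower
  adjoint to \<open>f'\<close>.\<close>


section \<open>Derivation operators\<close>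

text \<open>One construction serves all eleven cases because every context morphism in question is
  separately continuous: by definition for conceptual pairs, directly for concept continuous ones,
  and as a consequence of density for dense embeddings. The formulas for f and f' and their
  uniqueness rest on this alone; the other defining properties are checked separately and recombined
  by cases on the category. Likewise the canonical map is concept continuous, conceptual, dense and
  an embedding at once, so it lies in every category.

  The universal property is proved among context morphisms and then carried to lattice morphisms by
  the bijection \<open>identify\<close>. That bijection is the delicate point for the starred
  categories, where a lattice morphism is one map but a context morphism is two. The relation
  \<open>double_adjoint\<close> keeps both ends of a chain of adjoints in view: each end determines
  the other, and surjectivity and injectivity pass between them. So the doubly residual cases reuse
  the hom sets computed for doubly residuated maps.\<close>

lemma up_subset: "up K A \<subseteq> attributes K"
  by (auto simp: up_def)

lemma down_subset: "down K B \<subseteq> objects K"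
  by (auto simp: down_def)

lemma up_antimono: "A \<subseteq> A' \<Longrightarrow> up K A' \<subseteq> up K A"
  by (auto simp: up_def)

lemma down_antimono: "B \<subseteq> B' \<Longrightarrow> down K B' \<subseteq> down K B"
  by (auto simp: down_def)

lemma subset_down_up: "A \<subseteq> objects K \<Longrightarrow> A \<subseteq> down K (up K A)"
  by (auto simp: up_def down_def)

lemma subset_up_down: "B \<subseteq> attributes K \<Longrightarrow> B \<subseteq> up K (down K B)"
  by (auto simp: up_def down_def)

lemma up_down_up: "A \<subseteq> objects K \<Longrightarrow> up K (down K (up K A)) = up K A"
  by (intro subset_antisym up_antimono subset_down_up subset_up_down up_subset)

lemma down_up_down: "B \<subseteq> attributes K \<Longrightarrow> down K (up K (down K B)) = down K B"
  by (intro subset_antisym down_antimono subset_down_up subset_up_down down_subset)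

lemma down_in_extents: "B \<subseteq> attributes K \<Longrightarrow> down K B \<in> extents K"
  by (auto simp: extents_def down_up_down down_subset[THEN subsetD])

lemma up_in_intents: "A \<subseteq> objects K \<Longrightarrow> up K A \<in> intents K"
  by (auto simp: intents_def up_down_up up_subset[THEN subsetD])

lemma extentsD: "A \<in> extents K \<Longrightarrow> down K (up K A) = A" "A \<in> extents K \<Longrightarrow> A \<subseteq> objects K"
  by (auto simp: extents_def)

lemma intentsD: "B \<in> intents K \<Longrightarrow> up K (down K B) = B" "B \<in> intents K \<Longrightarrow> B \<subseteq> attributes K"
  by (auto simp: intents_def)

lemma conceptsD:
  assumes "(A, B) \<in> concepts K"
  shows "down K B = A" "up K A = B" "A \<subseteq> objects K" "B \<subseteq> attributes K"
    "A \<in> extents K" "B \<in> intents K"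
proof -
  show *: "down K B = A" "up K A = B"
    using assms unfolding concepts_def by blast+
  then show "A \<subseteq> objects K" "B \<subseteq> attributes K"
    using down_subset[of K B] up_subset[of K A] by simp_all
  then show "A \<in> extents K" "B \<in> intents K"
    using * by (simp_all add: extents_def intents_def)
qed

lemma extent_concept: "A \<in> extents K \<Longrightarrow> (A, up K A) \<in> concepts K"
  by (simp add: concepts_def extentsD)

lemma intent_concept: "B \<in> intents K \<Longrightarrow> (down K B, B) \<in> concepts K"
  by (simp add: concepts_def intentsD)


section \<open>Composition of mapping pairs\<close>

lemma mapping_pairs_iff:
  "(\<alpha>, \<beta>) \<in> mapping_pairs K L \<longleftrightarrow>
     \<alpha> \<in> objects K \<rightarrow>\<^sub>E objects L \<and> \<beta> \<in> attributes K \<rightarrow>\<^sub>E attributes L"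
  by (simp add: mapping_pairs_def)

lemma pair_comp_in_mapping_pairs:
  "p \<in> mapping_pairs K L \<Longrightarrow> q \<in> mapping_pairs L M \<Longrightarrow> pair_comp K q p \<in> mapping_pairs K M"
  by (auto simp: mapping_pairs_def pair_comp_def compose_def PiE_iff)

lemma pair_id_in_mapping_pairs: "pair_id K \<in> mapping_pairs K K"
  by (auto simp: mapping_pairs_def pair_id_def)

lemma compose_restrict_id: "f \<in> A \<rightarrow>\<^sub>E B \<Longrightarrow> compose A f (restrict id A) = f"
  by (auto simp: compose_def PiE_iff extensional_def fun_eq_iff)

lemma restrict_id_compose: "f \<in> A \<rightarrow>\<^sub>E B \<Longrightarrow> compose A (restrict id B) f = f"
  by (auto simp: compose_def PiE_iff extensional_def fun_eq_iff)

lemma pair_comp_id: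
  assumes "p \<in> mapping_pairs K L"
  shows "pair_comp K p (pair_id K) = p" "pair_comp K (pair_id L) p = p"
  using assms
  by (auto simp: mapping_pairs_def pair_comp_def pair_id_def compose_restrict_id
      restrict_id_compose)

lemma pair_comp_assoc:
  assumes "p \<in> mapping_pairs K L"
  shows "pair_comp K r (pair_comp K q p) = pair_comp K (pair_comp L r q) p"
  using assms by (auto simp: mapping_pairs_def pair_comp_def compose_def PiE_iff)

section \<open>Images, preimages and closures under composition\<close>

lemma image_compose: "X \<subseteq> A \<Longrightarrow> compose A g f ` X = g ` f ` X"
  by (force simp: compose_def)

lemma vimage_compose: "f \<in> A \<rightarrow>\<^sub>E B \<Longrightarrow> compose A g f -` Y \<inter> A = f -` (g -` Y \<inter> B) \<inter> A"
  by (auto simp: compose_def)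

text \<open>An attribute n above \<alpha>[A] yields the extent \<open>down L {n}\<close>, whose
  preimage is an extent containing A and hence its closure. Thus replacing a set by its closure does
  not change what its image generates; compositions of conceptual and of dense pairs depend on
  this.\<close>

lemma up_image_closure:
  assumes p: "(\<alpha>, \<beta>) \<in> mapping_pairs K L" and sc: "separately_continuous K L (\<alpha>, \<beta>)"
    and A: "A \<subseteq> objects K"
  shows "up L (\<alpha> ` down K (up K A)) = up L (\<alpha> ` A)"
proof (rule subset_antisym)
  show "up L (\<alpha> ` down K (up K A)) \<subseteq> up L (\<alpha> ` A)"
    by (intro up_antimono image_mono subset_down_up A)
  show "up L (\<alpha> ` A) \<subseteq> up L (\<alpha> ` down K (up K A))"
  proof
    fix n assume n: "n \<in> up L (\<alpha> ` A)"
    let ?X = "\<alpha> -` down L {n} \<inter> objects K"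
    have "down L {n} \<in> extents L"
      using n by (intro down_in_extents) (auto simp: up_def)
    then have "?X \<in> extents K"
      using sc by (auto simp: separately_continuous_def)
    moreover have "A \<subseteq> ?X"
      using A n p by (auto simp: up_def down_def mapping_pairs_iff)
    ultimately have "down K (up K A) \<subseteq> ?X"
      by (metis extentsD(1) up_antimono down_antimono)
    then show "n \<in> up L (\<alpha> ` down K (up K A))"
      using n by (auto simp: up_def down_def)
  qed
qed

lemma down_image_closure:
  assumes p: "(\<alpha>, \<beta>) \<in> mapping_pairs K L" and sc: "separately_continuous K L (\<alpha>, \<beta>)"
    and B: "B \<subseteq> attributes K"
  shows "down L (\<beta> ` up K (down K B)) = down L (\<beta> ` B)"
proof (rule subset_antisym)
  show "down L (\<beta> ` up K (down K B)) \<subseteq> down L (\<beta> ` B)"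
    by (intro down_antimono image_mono subset_up_down B)
  show "down L (\<beta> ` B) \<subseteq> down L (\<beta> ` up K (down K B))"
  proof
    fix h assume h: "h \<in> down L (\<beta> ` B)"
    let ?X = "\<beta> -` up L {h} \<inter> attributes K"
    have "up L {h} \<in> intents L"
      using h by (intro up_in_intents) (auto simp: down_def)
    then have "?X \<in> intents K"
      using sc by (auto simp: separately_continuous_def)
    moreover have "B \<subseteq> ?X"
      using B h p by (auto simp: up_def down_def mapping_pairs_iff)
    ultimately have "up K (down K B) \<subseteq> ?X"
      by (metis intentsD(1) up_antimono down_antimono)
    then show "h \<in> down L (\<beta> ` up K (down K B))"
      using h by (auto simp: up_def down_def)
  qed
qed

lemma separately_continuous_comp:
  assumes "p \<in> mapping_pairs K L" "separately_continuous K L p" "separately_continuous L M q"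
  shows "separately_continuous K M (pair_comp K q p)"
proof -
  obtain \<alpha> \<beta> \<gamma> \<delta> where [simp]: "p = (\<alpha>, \<beta>)" "q = (\<gamma>, \<delta>)"
    by (cases p; cases q)
  show ?thesis
    \<comment> \<open>Inner preimages stay in the form \<gamma>-preimage intersected with
      \<open>objects L\<close>, as this whole set is the extent of L to which continuity of the
      first pair applies; likewise for intents.\<close>
    using assms vimage_compose[of \<alpha> "objects K" "objects L" \<gamma>]
      vimage_compose[of \<beta> "attributes K" "attributes L" \<delta>]
    by (simp add: separately_continuous_def pair_comp_def mapping_pairs_iff del: vimage_Int)
qed

lemma concept_continuous_comp:
  assumes "p \<in> mapping_pairs K L" "concept_continuous K L p" "concept_continuous L M q"
  shows "concept_continuous K M (pair_comp K q p)"
proof -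
  obtain \<alpha> \<beta> \<gamma> \<delta> where [simp]: "p = (\<alpha>, \<beta>)" "q = (\<gamma>, \<delta>)"
    by (cases p; cases q)
  have "(compose (objects K) \<gamma> \<alpha> -` C \<inter> objects K,
      compose (attributes K) \<delta> \<beta> -` D \<inter> attributes K) \<in> concepts K"
    if CD: "(C, D) \<in> concepts M" for C D
  proof -
    have "(\<gamma> -` C \<inter> objects L, \<delta> -` D \<inter> attributes L) \<in> concepts L"
      using assms(3) CD unfolding concept_continuous_def by fastforce
    then have "(\<alpha> -` (\<gamma> -` C \<inter> objects L) \<inter> objects K,
        \<beta> -` (\<delta> -` D \<inter> attributes L) \<inter> attributes K) \<in> concepts K"
      using assms(2) by (simp add: concept_continuous_def split_beta del: vimage_Int) force
    then show ?thesis
      using assms(1) by (simp add: mapping_pairs_iff vimage_compose[of \<alpha> _ "objects L"]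
          vimage_compose[of \<beta> _ "attributes L"] del: vimage_Int)
  qed
  then show ?thesis
    by (simp add: concept_continuous_def pair_comp_def split_beta)
qed

text \<open>The components of the intermediate concept are not images of A and B, but since
  (\<open>?C\<close>, \<open>?D\<close>) is a concept, \<open>?C\<close> is the closure of
  \<alpha>[A] and \<open>?D\<close> the closure of \<beta>[B]. The outer pair cannot distinguish
  these sets from their closures, which gives the concept generated by the composite images.\<close>

lemma conceptual_comp:
  assumes p: "p \<in> mapping_pairs K L" and q: "q \<in> mapping_pairs L M"
    and cp: "conceptual K L p" and cq: "conceptual L M q"
  shows "conceptual K M (pair_comp K q p)"
proof -
  obtain \<alpha> \<beta> \<gamma> \<delta> where [simp]: "p = (\<alpha>, \<beta>)" "q = (\<gamma>, \<delta>)"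
    by (cases p; cases q)
  have sp: "separately_continuous K L p" and sq: "separately_continuous L M q"
    using cp cq by (auto simp: conceptual_def)
  have "(down M (\<delta> ` \<beta> ` B), up M (\<gamma> ` \<alpha> ` A)) \<in> concepts M" if AB: "(A, B) \<in> concepts K" for A B
  proof -
    let ?C = "down L (\<beta> ` B)" and ?D = "up L (\<alpha> ` A)"
    have CD: "(?C, ?D) \<in> concepts L"
      using cp AB by (auto simp: conceptual_def)
    then have *: "(down M (\<delta> ` ?D), up M (\<gamma> ` ?C)) \<in> concepts M"
      using cq by (auto simp: conceptual_def)
    have "\<alpha> ` A \<subseteq> objects L" "\<beta> ` B \<subseteq> attributes L"
      using p conceptsD[OF AB] by (auto simp: mapping_pairs_iff)
    then have "up M (\<gamma> ` ?C) = up M (\<gamma> ` \<alpha> ` A)" "down M (\<delta> ` ?D) = down M (\<delta> ` \<beta> ` B)"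
      using up_image_closure[of \<gamma> \<delta> L M "\<alpha> ` A"] down_image_closure[of \<gamma> \<delta> L M "\<beta> ` B"]
        q sq conceptsD[OF CD] by simp_all
    then show ?thesis
      using * by simp
  qed
  moreover have "separately_continuous K M (pair_comp K q p)"
    using p sp sq by (rule separately_continuous_comp)
  ultimately show ?thesis
    by (auto simp: conceptual_def pair_comp_def image_compose conceptsD)
qed

lemma embedding_comp:
  assumes "p \<in> mapping_pairs K L" "embedding K L p" "embedding L M q"
  shows "embedding K M (pair_comp K q p)"
proof -
  obtain \<alpha> \<beta> \<gamma> \<delta> where [simp]: "p = (\<alpha>, \<beta>)" "q = (\<gamma>, \<delta>)"
    by (cases p; cases q)
  have "\<alpha> g \<in> objects L" "\<beta> m \<in> attributes L" if "g \<in> objects K" "m \<in> attributes K" for g m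
    using assms(1) that by (auto simp: mapping_pairs_iff)
  then show ?thesis
    using assms(2,3) by (simp add: embedding_def pair_comp_def compose_eq)
qed

lemma dense_pairD:
  assumes "dense_pair K L (\<alpha>, \<beta>)"
  shows "C \<subseteq> objects L \<Longrightarrow> \<exists>A\<subseteq>objects K. down L (up L C) = down L (up L (\<alpha> ` A))"
    "D \<subseteq> attributes L \<Longrightarrow> \<exists>B\<subseteq>attributes K. up L (down L D) = up L (down L (\<beta> ` B))"
  using assms unfolding dense_pair_def by simp_all

text \<open>A set A' whose \<gamma>-image generates the given closure may be exchanged for an
  \<alpha>-image with the same closure in L. Separate continuity of the outer pair ensures that
  their \<gamma>-images then generate the same closure in M.\<close>

lemma dense_pair_comp:
  assumes p: "p \<in> mapping_pairs K L" and q: "q \<in> mapping_pairs L M"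
    and sq: "separately_continuous L M q"
    and dp: "dense_pair K L p" and dq: "dense_pair L M q"
  shows "dense_pair K M (pair_comp K q p)"
proof -
  obtain \<alpha> \<beta> \<gamma> \<delta> where [simp]: "p = (\<alpha>, \<beta>)" "q = (\<gamma>, \<delta>)"
    by (cases p; cases q)
  have "\<exists>A\<subseteq>objects K. down M (up M C) = down M (up M (compose (objects K) \<gamma> \<alpha> ` A))"
    if C: "C \<subseteq> objects M" for C
  proof -
    obtain A' where A': "A' \<subseteq> objects L" "down M (up M C) = down M (up M (\<gamma> ` A'))"
      using dense_pairD(1)[of _ _ \<gamma> \<delta>] dq C by (metis \<open>q = (\<gamma>, \<delta>)\<close>)
    obtain A where A: "A \<subseteq> objects K" "down L (up L A') = down L (up L (\<alpha> ` A))"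
      using dense_pairD(1)[of _ _ \<alpha> \<beta>] dp A' by (metis \<open>p = (\<alpha>, \<beta>)\<close>)
    have "\<alpha> ` A \<subseteq> objects L"
      using p A by (auto simp: mapping_pairs_iff)
    then have "up M (\<gamma> ` A') = up M (\<gamma> ` \<alpha> ` A)"
      using up_image_closure[of \<gamma> \<delta> L M A'] up_image_closure[of \<gamma> \<delta> L M "\<alpha> ` A"] q sq A' A by simp
    then show ?thesis
      using A A' by (intro exI[of _ A]) (simp add: image_compose)
  qed
  moreover have "\<exists>B\<subseteq>attributes K. up M (down M D) = up M (down M (compose (attributes K) \<delta> \<beta> ` B))"
    if D: "D \<subseteq> attributes M" for D
  proof -
    obtain B' where B': "B' \<subseteq> attributes L" "up M (down M D) = up M (down M (\<delta> ` B'))"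
      using dense_pairD(2)[of _ _ \<gamma> \<delta>] dq D by (metis \<open>q = (\<gamma>, \<delta>)\<close>)
    obtain B where B: "B \<subseteq> attributes K" "up L (down L B') = up L (down L (\<beta> ` B))"
      using dense_pairD(2)[of _ _ \<alpha> \<beta>] dp B' by (metis \<open>p = (\<alpha>, \<beta>)\<close>)
    have "\<beta> ` B \<subseteq> attributes L"
      using p B by (auto simp: mapping_pairs_iff)
    then have "down M (\<delta> ` B') = down M (\<delta> ` \<beta> ` B)"
      using down_image_closure[of \<gamma> \<delta> L M B'] down_image_closure[of \<gamma> \<delta> L M "\<beta> ` B"] q sq B' B by simp
    then show ?thesis
      using B B' by (intro exI[of _ B]) (simp add: image_compose)
  qed
  ultimately show ?thesis
    by (simp add: dense_pair_def pair_comp_def)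
qed

text \<open>Every extent and every intent is a component of a concept, and so is its
  preimage.\<close>

lemma concept_continuous_imp_separately_continuous:
  assumes "concept_continuous K L p"
  shows "separately_continuous K L p"
proof -
  obtain \<alpha> \<beta> where [simp]: "p = (\<alpha>, \<beta>)"
    by (cases p)
  have *: "(\<alpha> -` C \<inter> objects K, \<beta> -` D \<inter> attributes K) \<in> concepts K" if "(C, D) \<in> concepts L" for C D
    using assms that by (auto simp: concept_continuous_def)
  show ?thesis
    unfolding separately_continuous_def
    using conceptsD(5)[OF *[OF extent_concept]] conceptsD(6)[OF *[OF intent_concept]] by auto
qed

text \<open>By density an extent of \<open>L\<close> is of the form \<open>\<beta>[B]\<^sup>\<down>\<close>, and its preimage under an
  embedding is then \<open>B\<^sup>\<down>\<close>.\<close>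

lemma dense_embedding_imp_separately_continuous:
  assumes p: "p \<in> mapping_pairs K L" and d: "dense_pair K L p" and e: "embedding K L p"
  shows "separately_continuous K L p"
proof -
  obtain \<alpha> \<beta> where [simp]: "p = (\<alpha>, \<beta>)"
    by (cases p)
  have "\<alpha> -` C \<inter> objects K \<in> extents K" if C: "C \<in> extents L" for C
  proof -
    obtain B where B: "B \<subseteq> attributes K" "up L (down L (up L C)) = up L (down L (\<beta> ` B))"
      using dense_pairD(2)[of K L \<alpha> \<beta> "up L C"] d up_subset[of L C] by auto
    have "\<beta> ` B \<subseteq> attributes L"
      using B p by (auto simp: mapping_pairs_iff)
    then have "C = down L (\<beta> ` B)"
      using B C by (metis extentsD(1) down_up_down)
    then have "\<alpha> -` C \<inter> objects K = down K B"
      using e p B by (auto simp: down_def embedding_def mapping_pairs_iff subset_iff)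
    then show ?thesis
      using B by (simp add: down_in_extents)
  qed
  moreover have "\<beta> -` D \<inter> attributes K \<in> intents K" if D: "D \<in> intents L" for D
  proof -
    obtain A where A: "A \<subseteq> objects K" "down L (up L (down L D)) = down L (up L (\<alpha> ` A))"
      using dense_pairD(1)[of K L \<alpha> \<beta> "down L D"] d down_subset[of L D] by auto
    have "\<alpha> ` A \<subseteq> objects L"
      using A p by (auto simp: mapping_pairs_iff)
    then have "D = up L (\<alpha> ` A)"
      using A D by (metis intentsD(1) up_down_up)
    then have "\<beta> -` D \<inter> attributes K = up K A"
      using e p A by (auto simp: up_def embedding_def mapping_pairs_iff subset_iff)
    then show ?thesis
      using A by (simp add: up_in_intents)
  qed
  ultimately show ?thesis
    by (simp add: separately_continuous_def)
qed

lemma context_hom_imp_mapping_pairs: "p \<in> context_hom C K L \<Longrightarrow> p \<in> mapping_pairs K L"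
  by (simp add: context_hom_def)

text \<open>The common property of the eight categories. Composition of dense pairs and both halves
  of the universal property draw on it without regard to the category.\<close>

lemma context_hom_imp_separately_continuous:
  "p \<in> context_hom C K L \<Longrightarrow> separately_continuous K L p"
  by (cases C)
    (auto simp: context_hom_def conceptual_def concept_continuous_imp_separately_continuous
      dense_embedding_imp_separately_continuous)

lemma restrict_id_image: "X \<subseteq> A \<Longrightarrow> restrict id A ` X = X"
  by force

lemma restrict_id_vimage: "X \<subseteq> A \<Longrightarrow> restrict id A -` X \<inter> A = X"
  by force

lemma pair_id_in_context_hom: "pair_id K \<in> context_hom C K K"
proof -
  have 1: "separately_continuous K K (pair_id K)"
    by (auto simp: separately_continuous_def pair_id_def restrict_id_vimage extentsD intentsD)
  have "(down K (restrict id (attributes K) ` B), up K (restrict id (objects K) ` A)) \<in> concepts K"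
    if AB: "(A, B) \<in> concepts K" for A B
    unfolding restrict_id_image[OF conceptsD(3)[OF AB]] restrict_id_image[OF conceptsD(4)[OF AB]]
    using conceptsD(1,2)[OF AB] AB by simp
  then have 2: "conceptual K K (pair_id K)"
    using 1 unfolding conceptual_def pair_id_def by blast
  have 3: "concept_continuous K K (pair_id K)"
    by (auto simp: concept_continuous_def pair_id_def restrict_id_vimage conceptsD)
  have 4: "embedding K K (pair_id K)"
    by (auto simp: embedding_def pair_id_def)
  have 5: "dense_pair K K (pair_id K)"
    unfolding dense_pair_def pair_id_def prod.case by (metis restrict_id_image)
  show ?thesis
    using 1 2 3 4 5 by (cases C) (auto simp: context_hom_def pair_id_in_mapping_pairs)
qed

text \<open>Each category is cut out by a combination of properties with their own composition laws.
  The law for density asks in addition for separate continuity of the outer pair, which every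
  category supplies.\<close>

lemma pair_comp_in_context_hom:
  assumes p: "p \<in> context_hom C K L" and q: "q \<in> context_hom C L M"
  shows "pair_comp K q p \<in> context_hom C K M"
proof -
  note map = context_hom_imp_mapping_pairs[OF p] context_hom_imp_mapping_pairs[OF q]
  note sc = context_hom_imp_separately_continuous[OF p] context_hom_imp_separately_continuous[OF q]
  note map_comp = pair_comp_in_mapping_pairs[OF map]
    and sc_comp = separately_continuous_comp[OF map(1) sc]
    and dense_comp = dense_pair_comp[OF map sc(2)]
    and embedding_comp = embedding_comp[OF map(1), of M q]
    and conceptual_comp = conceptual_comp[OF map]
    and cc_comp = concept_continuous_comp[OF map(1), of M q]
  show ?thesis
    using p q map_comp sc_comp dense_comp embedding_comp conceptual_comp cc_comp
    by (cases C) (simp_all add: context_hom_def)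
qed

lemma context_category: "context_category C T1 T2 T3 T4"
  unfolding context_category_def
  by (intro allI impI conjI ballI pair_id_in_context_hom)
    (rule pair_comp_id[OF context_hom_imp_mapping_pairs] pair_comp_in_context_hom
      pair_comp_assoc[OF context_hom_imp_mapping_pairs], assumption+)+


section \<open>Complete contexts\<close>

text \<open>Principal ideals and, below, principal filters: they turn out to be exactly the extents
  and the intents of a complete context.\<close>

definition down_set :: "'x gorder \<Rightarrow> 'x \<Rightarrow> 'x set" where
  "down_set L a = {x \<in> carrier L. x \<sqsubseteq>\<^bsub>L\<^esub> a}"

definition up_set :: "'x gorder \<Rightarrow> 'x \<Rightarrow> 'x set" where
  "up_set L a = {x \<in> carrier L. a \<sqsubseteq>\<^bsub>L\<^esub> x}"

lemma objects_complete_context [simp]: "objects (complete_context L) = carrier L"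
  by (simp add: complete_context_def)

lemma attributes_complete_context [simp]: "attributes (complete_context L) = carrier L"
  by (simp add: complete_context_def)

lemma incidence_complete_context [simp]:
  "(x, y) \<in> incidence (complete_context L) \<longleftrightarrow> x \<in> carrier L \<and> y \<in> carrier L \<and> x \<sqsubseteq>\<^bsub>L\<^esub> y"
  by (simp add: complete_context_def)

lemma is_context_complete_context: "is_context (complete_context L)"
  by (auto simp: is_context_def)

section \<open>Order duality and indirect reasoning in complete lattices\<close>

lemma complete_lattice_dual:
  assumes "complete_lattice L"
  shows "complete_lattice (inv_gorder L)"
proof -
  interpret L: complete_lattice L by fact
  interpret D: partial_order "inv_gorder L" by (rule L.dual_order)
  show ?thesis
    by unfold_locales (simp_all add: L.sup_exists L.inf_exists)
qed

lemma sup_dual: "\<Squnion>\<^bsub>inv_gorder L\<^esub> A = \<Sqinter>\<^bsub>L\<^esub> A"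
  by (simp add: sup_def inf_def)

context complete_lattice
begin

lemma sup_le_iff:
  "A \<subseteq> carrier L \<Longrightarrow> y \<in> carrier L \<Longrightarrow> \<Squnion>A \<sqsubseteq> y \<longleftrightarrow> (\<forall>x\<in>A. x \<sqsubseteq> y)"
  by (meson subsetD sup_least sup_upper le_trans sup_closed)

text \<open>Writes the order as an equation between joins, so that a join preserving map is seen to
  be monotone and an injective one to reflect the order.\<close>

lemma le_iff_sup_eq:
  assumes "x \<in> carrier L" "y \<in> carrier L"
  shows "x \<sqsubseteq> y \<longleftrightarrow> \<Squnion>{x, y} = y"
proof
  assume "x \<sqsubseteq> y"
  then show "\<Squnion>{x, y} = y"
    using assms by (intro le_antisym sup_least sup_upper sup_closed) auto
next
  assume "\<Squnion>{x, y} = y"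
  then show "x \<sqsubseteq> y"
    using assms sup_upper[of "{x, y}" x] by simp
qed

lemma le_inf_iff:
  "A \<subseteq> carrier L \<Longrightarrow> y \<in> carrier L \<Longrightarrow> y \<sqsubseteq> \<Sqinter>A \<longleftrightarrow> (\<forall>x\<in>A. y \<sqsubseteq> x)"
  by (meson subsetD inf_greatest inf_lower le_trans inf_closed)

text \<open>Indirect equality. It suits joins, which \<open>sup_le_iff\<close> describes through
  their upper bounds; \<open>eqI_below\<close> plays the same role for meets.\<close>

lemma eqI_above:
  "x \<in> carrier L \<Longrightarrow> y \<in> carrier L \<Longrightarrow> (\<And>z. z \<in> carrier L \<Longrightarrow> x \<sqsubseteq> z \<longleftrightarrow> y \<sqsubseteq> z) \<Longrightarrow> x = y"
  by (meson le_antisym le_refl)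

lemma eqI_below:
  "x \<in> carrier L \<Longrightarrow> y \<in> carrier L \<Longrightarrow> (\<And>z. z \<in> carrier L \<Longrightarrow> z \<sqsubseteq> x \<longleftrightarrow> z \<sqsubseteq> y) \<Longrightarrow> x = y"
  by (meson le_antisym le_refl)

end

text \<open>\<open>complete_context\<close> takes a \<open>gorder\<close>, whereas \<open>complete_lattice\<close> fixes a record of the
  more general type \<open>gorder_scheme\<close>.\<close>

locale gorder_complete_lattice = complete_lattice L for L :: "'x gorder" (structure)
begin

lemma down_set_inject:
  assumes "a \<in> carrier L" "b \<in> carrier L"
  shows "down_set L a = down_set L b \<longleftrightarrow> a = b"
  using assms by (auto simp: down_set_def Set.set_eq_iff intro: eqI_below)

lemma up_set_inject:
  assumes "a \<in> carrier L" "b \<in> carrier L"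
  shows "up_set L a = up_set L b \<longleftrightarrow> a = b"
  using assms by (auto simp: up_set_def Set.set_eq_iff intro: eqI_above)

lemma up_complete_context:
  "A \<subseteq> carrier L \<Longrightarrow> up (complete_context L) A = up_set L (\<Squnion>A)"
  by (auto simp: up_def up_set_def sup_le_iff)

lemma down_complete_context:
  "B \<subseteq> carrier L \<Longrightarrow> down (complete_context L) B = down_set L (\<Sqinter>B)"
  by (auto simp: down_def down_set_def le_inf_iff)

lemma sup_down_set: "a \<in> carrier L \<Longrightarrow> \<Squnion>(down_set L a) = a"
  by (intro le_antisym sup_least sup_upper sup_closed) (auto simp: down_set_def)

lemma inf_up_set: "a \<in> carrier L \<Longrightarrow> \<Sqinter>(up_set L a) = a"
  by (intro le_antisym inf_greatest inf_lower inf_closed) (auto simp: up_set_def)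

lemma down_set_subset: "down_set L a \<subseteq> carrier L"
  by (auto simp: down_set_def)

lemma up_set_subset: "up_set L a \<subseteq> carrier L"
  by (auto simp: up_set_def)

lemma up_down_set: "a \<in> carrier L \<Longrightarrow> up (complete_context L) (down_set L a) = up_set L a"
  by (simp add: up_complete_context down_set_subset sup_down_set)

lemma down_up_set: "a \<in> carrier L \<Longrightarrow> down (complete_context L) (up_set L a) = down_set L a"
  by (simp add: down_complete_context up_set_subset inf_up_set)

lemma extents_complete_context: "extents (complete_context L) = down_set L ` carrier L"
proof (intro Set.set_eqI iffI)
  fix A assume A: "A \<in> extents (complete_context L)"
  then have "A \<subseteq> carrier L"
    using extentsD(2) by fastforce
  then have "A = down_set L (\<Squnion>A)"
    using extentsD(1)[OF A] by (simp add: up_complete_context down_up_set)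
  then show "A \<in> down_set L ` carrier L"
    using \<open>A \<subseteq> carrier L\<close> sup_closed by blast
next
  fix A assume "A \<in> down_set L ` carrier L"
  then show "A \<in> extents (complete_context L)"
    using down_set_subset by (auto simp: extents_def up_down_set down_up_set)
qed

lemma intents_complete_context: "intents (complete_context L) = up_set L ` carrier L"
proof (intro Set.set_eqI iffI)
  fix A assume A: "A \<in> intents (complete_context L)"
  then have "A \<subseteq> carrier L"
    using intentsD(2) by fastforce
  then have "A = up_set L (\<Sqinter>A)"
    using intentsD(1)[OF A] by (simp add: down_complete_context up_down_set)
  then show "A \<in> up_set L ` carrier L"
    using \<open>A \<subseteq> carrier L\<close> inf_closed by blast
next
  fix A assume "A \<in> up_set L ` carrier L"
  then show "A \<in> intents (complete_context L)"
    using up_set_subset by (auto simp: intents_def up_down_set down_up_set)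
qed

text \<open>An extent is a principal ideal, and its intent is the principal filter of the same
  element. So concepts of the complete context correspond to elements of L.\<close>

lemma concepts_complete_context:
  "concepts (complete_context L) = (\<lambda>a. (down_set L a, up_set L a)) ` carrier L"
proof (intro Set.set_eqI iffI)
  fix c assume c: "c \<in> concepts (complete_context L)"
  obtain A B where [simp]: "c = (A, B)"
    by (cases c)
  have "A \<in> extents (complete_context L)" "up (complete_context L) A = B"
    using conceptsD[of A B] c by auto
  then show "c \<in> (\<lambda>a. (down_set L a, up_set L a)) ` carrier L"
    by (auto simp: extents_complete_context up_down_set)
next
  fix c assume "c \<in> (\<lambda>a. (down_set L a, up_set L a)) ` carrier L"
  then show "c \<in> concepts (complete_context L)"
    by (auto simp: concepts_def up_down_set down_up_set)
qed

text \<open>The left side has the shape of the conceptuality condition. The two polars are the ideal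
  of the meet of B and the filter of the join of A, and these form a concept only if they belong to
  one element.\<close>

lemma down_up_in_concepts_iff:
  assumes "A \<subseteq> carrier L" "B \<subseteq> carrier L"
  shows "(down (complete_context L) B, up (complete_context L) A) \<in> concepts (complete_context L)
    \<longleftrightarrow> \<Squnion>A = \<Sqinter>B"
proof -
  have "(down_set L (\<Sqinter>B), up_set L (\<Squnion>A)) \<in> concepts (complete_context L) \<longleftrightarrow>
      (\<exists>a\<in>carrier L. \<Sqinter>B = a \<and> \<Squnion>A = a)"
    unfolding concepts_complete_context
    using assms by (auto simp: down_set_inject up_set_inject)
  then show ?thesis
    using assms by (auto simp: up_complete_context down_complete_context)
qed

text \<open>Extents and intents of the target are principal, so continuity is tested on one element
  y at a time.\<close>

lemma separately_continuous_complete_context_iff: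
  assumes "(\<alpha>, \<beta>) \<in> mapping_pairs K (complete_context L)"
  shows "separately_continuous K (complete_context L) (\<alpha>, \<beta>) \<longleftrightarrow>
    (\<forall>y\<in>carrier L. {g \<in> objects K. \<alpha> g \<sqsubseteq> y} \<in> extents K \<and>
       {m \<in> attributes K. y \<sqsubseteq> \<beta> m} \<in> intents K)"
proof -
  have "\<alpha> -` down_set L y \<inter> objects K = {g \<in> objects K. \<alpha> g \<sqsubseteq> y}"
    "\<beta> -` up_set L y \<inter> attributes K = {m \<in> attributes K. y \<sqsubseteq> \<beta> m}" for y
    using assms by (auto simp: mapping_pairs_iff down_set_def up_set_def)
  then show ?thesis
    by (auto simp: separately_continuous_def extents_complete_context intents_complete_context)
qed

lemma concept_continuous_complete_context_iff:
  assumes "(\<alpha>, \<beta>) \<in> mapping_pairs K (complete_context L)"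
  shows "concept_continuous K (complete_context L) (\<alpha>, \<beta>) \<longleftrightarrow>
    (\<forall>y\<in>carrier L. ({g \<in> objects K. \<alpha> g \<sqsubseteq> y}, {m \<in> attributes K. y \<sqsubseteq> \<beta> m}) \<in> concepts K)"
proof -
  have "\<alpha> -` down_set L y \<inter> objects K = {g \<in> objects K. \<alpha> g \<sqsubseteq> y}"
    "\<beta> -` up_set L y \<inter> attributes K = {m \<in> attributes K. y \<sqsubseteq> \<beta> m}" for y
    using assms by (auto simp: mapping_pairs_iff down_set_def up_set_def)
  then show ?thesis
    by (auto simp: concept_continuous_def concepts_complete_context)
qed

end

lemma gorder_complete_lattice_iff: "gorder_complete_lattice L \<longleftrightarrow> complete_lattice L"
  by (simp add: gorder_complete_lattice_def)


section \<open>Adjoint maps between complete lattices\<close>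

text \<open>The adjoint functor theorem for complete lattices, in pointwise form: a is the value at
  b of the upper adjoint. No adjoint map is named because the condition is to be read as "preimages
  of principal ideals are principal ideals", which is continuity on extents.\<close>

lemma sup_pres_iff_residuated:
  fixes L :: "'x gorder" and L' :: "'y gorder"
  assumes "complete_lattice L" "complete_lattice L'" and f: "f \<in> carrier L \<rightarrow> carrier L'"
  shows "sup_pres L L' f \<longleftrightarrow>
    (\<forall>b\<in>carrier L'. \<exists>a\<in>carrier L. \<forall>x\<in>carrier L. f x \<sqsubseteq>\<^bsub>L'\<^esub> b \<longleftrightarrow> x \<sqsubseteq>\<^bsub>L\<^esub> a)"
    (is "_ \<longleftrightarrow> ?res")
proof -
  interpret L: complete_lattice L by fact
  interpret L': complete_lattice L' by fact
  have fA: "f ` A \<subseteq> carrier L'" if "A \<subseteq> carrier L" for A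
    using f that by auto
  show ?thesis
  proof
    assume "sup_pres L L' f"
    then have pres: "f (\<Squnion>\<^bsub>L\<^esub> A) = \<Squnion>\<^bsub>L'\<^esub> (f ` A)" if "A \<subseteq> carrier L" for A
      using that by (simp add: sup_pres_def)
    have mono: "f x \<sqsubseteq>\<^bsub>L'\<^esub> f y" if "x \<in> carrier L" "y \<in> carrier L" "x \<sqsubseteq>\<^bsub>L\<^esub> y" for x y
    proof -
      have "f y = \<Squnion>\<^bsub>L'\<^esub> {f x, f y}"
        using that pres[of "{x, y}"] by (simp add: L.le_iff_sup_eq)
      then show ?thesis
        using that fA[of "{x, y}"] by (simp add: L'.le_iff_sup_eq)
    qed
    show ?res
    proof
      fix b assume b: "b \<in> carrier L'"
      \<comment> \<open>The join of \<open>?A\<close> is the largest x with f x \<le> b; that it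
        satisfies this inequality itself is where preservation of joins enters.\<close>
      let ?A = "{x \<in> carrier L. f x \<sqsubseteq>\<^bsub>L'\<^esub> b}"
      have A: "?A \<subseteq> carrier L" "\<Squnion>\<^bsub>L\<^esub> ?A \<in> carrier L"
        by auto
      have "f (\<Squnion>\<^bsub>L\<^esub> ?A) \<sqsubseteq>\<^bsub>L'\<^esub> b"
        unfolding pres[OF A(1)] using b fA[OF A(1)] by (auto simp: L'.sup_le_iff)
      then have "f x \<sqsubseteq>\<^bsub>L'\<^esub> b \<longleftrightarrow> x \<sqsubseteq>\<^bsub>L\<^esub> \<Squnion>\<^bsub>L\<^esub> ?A" if "x \<in> carrier L" for x
        using that b A f mono[of x "\<Squnion>\<^bsub>L\<^esub> ?A"] L.sup_upper[OF A(1), of x]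
          L'.le_trans[of "f x" "f (\<Squnion>\<^bsub>L\<^esub> ?A)" b]
        by (auto simp: Pi_iff)
      then show "\<exists>a\<in>carrier L. \<forall>x\<in>carrier L. f x \<sqsubseteq>\<^bsub>L'\<^esub> b \<longleftrightarrow> x \<sqsubseteq>\<^bsub>L\<^esub> a"
        using A(2) by blast
    qed
  next
    assume res: ?res
    have "f (\<Squnion>\<^bsub>L\<^esub> A) = \<Squnion>\<^bsub>L'\<^esub> (f ` A)" if A: "A \<subseteq> carrier L" for A
    proof (rule L'.eqI_above)
      fix b assume b: "b \<in> carrier L'"
      \<comment> \<open>Each upper bound b is moved across the adjunction to a, where it only has to
        be compared with the elements of A.\<close>
      then obtain a where a: "a \<in> carrier L" "\<And>x. x \<in> carrier L \<Longrightarrow> f x \<sqsubseteq>\<^bsub>L'\<^esub> b \<longleftrightarrow> x \<sqsubseteq>\<^bsub>L\<^esub> a"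
        using bspec[OF res b] by blast
      have "f (\<Squnion>\<^bsub>L\<^esub> A) \<sqsubseteq>\<^bsub>L'\<^esub> b \<longleftrightarrow> (\<forall>x\<in>A. x \<sqsubseteq>\<^bsub>L\<^esub> a)"
        using A a by (simp add: L.sup_le_iff)
      also have "\<dots> \<longleftrightarrow> (\<forall>x\<in>A. f x \<sqsubseteq>\<^bsub>L'\<^esub> b)"
        using A a(2) by blast
      also have "\<dots> \<longleftrightarrow> \<Squnion>\<^bsub>L'\<^esub> (f ` A) \<sqsubseteq>\<^bsub>L'\<^esub> b"
        using b fA[OF A] by (simp add: L'.sup_le_iff)
      finally show "f (\<Squnion>\<^bsub>L\<^esub> A) \<sqsubseteq>\<^bsub>L'\<^esub> b \<longleftrightarrow> \<Squnion>\<^bsub>L'\<^esub> (f ` A) \<sqsubseteq>\<^bsub>L'\<^esub> b" .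
    qed (use f A fA[OF A] in auto)
    then show "sup_pres L L' f"
      using assms by (simp add: sup_pres_def)
  qed
qed

lemma complete_lattice_dual_iff:
  fixes L :: "'x gorder"
  shows "complete_lattice (inv_gorder L) \<longleftrightarrow> complete_lattice L"
  using complete_lattice_dual[of L] complete_lattice_dual[of "inv_gorder L"]
  unfolding inv_gorder_inv by blast

text \<open>Meets are joins of the dual order, so facts about \<open>inf_pres\<close> are inherited
  from those about \<open>sup_pres\<close>.\<close>

lemma sup_pres_dual:
  fixes L :: "'x gorder" and L' :: "'y gorder"
  shows "sup_pres (inv_gorder L) (inv_gorder L') f \<longleftrightarrow> inf_pres L L' f"
  by (simp add: sup_pres_def inf_pres_def complete_lattice_dual_iff sup_dual)

lemma inf_pres_iff_residual:
  fixes L :: "'x gorder" and L' :: "'y gorder"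
  assumes "complete_lattice L" "complete_lattice L'" "f \<in> carrier L \<rightarrow> carrier L'"
  shows "inf_pres L L' f \<longleftrightarrow>
    (\<forall>b\<in>carrier L'. \<exists>a\<in>carrier L. \<forall>x\<in>carrier L. b \<sqsubseteq>\<^bsub>L'\<^esub> f x \<longleftrightarrow> a \<sqsubseteq>\<^bsub>L\<^esub> x)"
  using sup_pres_iff_residuated[of "inv_gorder L" "inv_gorder L'" f] assms
  by (simp add: sup_pres_dual complete_lattice_dual)

lemma adjoint_maps_iff:
  fixes L :: "'x gorder" and L' :: "'y gorder"
  assumes "complete_lattice L" "complete_lattice L'"
  shows "adjoint_maps L L' f g \<longleftrightarrow>
    f \<in> carrier L \<rightarrow> carrier L' \<and> g \<in> carrier L' \<rightarrow> carrier L \<and>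
    (\<forall>x\<in>carrier L. \<forall>y\<in>carrier L'. f x \<sqsubseteq>\<^bsub>L'\<^esub> y \<longleftrightarrow> x \<sqsubseteq>\<^bsub>L\<^esub> g y)"
proof -
  interpret L: complete_lattice L by fact
  interpret L': complete_lattice L' by fact
  show ?thesis
    by (auto simp: adjoint_maps_def galois_connection_def connection_def
        galois_connection_axioms_def L.partial_order_axioms L'.partial_order_axioms)
qed

lemma upper_adjoint_unique:
  fixes L :: "'x gorder" and L' :: "'y gorder"
  assumes "complete_lattice L" "complete_lattice L'"
    and "adjoint_maps L L' f g" "adjoint_maps L L' f g'"
    and "g \<in> extensional (carrier L')" "g' \<in> extensional (carrier L')"
  shows "g = g'"
proof -
  interpret L: complete_lattice L by fact
  interpret L': complete_lattice L' by fact
  show ?thesis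
    using assms(3-)
    by (intro extensionalityI[of _ "carrier L'"] L.eqI_below)
      (auto simp: adjoint_maps_iff[OF assms(1,2)])
qed

lemma lower_adjoint_unique:
  fixes L :: "'x gorder" and L' :: "'y gorder"
  assumes "complete_lattice L" "complete_lattice L'"
    and "adjoint_maps L L' f g" "adjoint_maps L L' f' g"
    and "f \<in> extensional (carrier L)" "f' \<in> extensional (carrier L)"
  shows "f = f'"
proof -
  interpret L: complete_lattice L by fact
  interpret L': complete_lattice L' by fact
  show ?thesis
    using assms(3-)
    by (intro extensionalityI[of _ "carrier L"] L'.eqI_above)
      (auto simp: adjoint_maps_iff[OF assms(1,2)])
qed

text \<open>An adjunction involves values on the carriers only. Hence adjoints have extensional
  representatives, as the definite descriptions of \<open>the_upper_adjoint\<close> and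
  \<open>the_lower_adjoint\<close> demand.\<close>

lemma adjoint_maps_restrict:
  fixes L :: "'x gorder" and L' :: "'y gorder"
  assumes "complete_lattice L" "complete_lattice L'"
  shows "adjoint_maps L L' (restrict f (carrier L)) g \<longleftrightarrow> adjoint_maps L L' f g"
    "adjoint_maps L L' f (restrict g (carrier L')) \<longleftrightarrow> adjoint_maps L L' f g"
  using assms by (auto simp: adjoint_maps_iff Pi_iff)

lemma the_upper_adjoint_eq:
  fixes L :: "'x gorder" and L' :: "'y gorder"
  assumes "complete_lattice L" "complete_lattice L'" "adjoint_maps L L' f g"
  shows "the_upper_adjoint L L' f = restrict g (carrier L')"
  unfolding the_upper_adjoint_def
  using assms by (intro the_equality)
    (auto simp: adjoint_maps_restrict intro: upper_adjoint_unique[of L L' f])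

lemma the_lower_adjoint_eq:
  fixes L :: "'x gorder" and L' :: "'y gorder"
  assumes "complete_lattice L" "complete_lattice L'" "adjoint_maps L L' f g"
  shows "the_lower_adjoint L' L g = restrict f (carrier L)"
  unfolding the_lower_adjoint_def
  using assms by (intro the_equality)
    (auto simp: adjoint_maps_restrict intro: lower_adjoint_unique[of L L' _ g])

text \<open>A chain of adjoints with a hidden middle map g from L' to L, to which f is lower and f'
  upper adjoint. Doubly residuated and doubly residual maps are the first and the last members of
  the same chains, so one relation handles both.\<close>

definition double_adjoint :: "'x gorder \<Rightarrow> 'y gorder \<Rightarrow> ('x \<Rightarrow> 'y) \<Rightarrow> ('x \<Rightarrow> 'y) \<Rightarrow> bool" where
  "double_adjoint L L' f f' \<longleftrightarrow> (\<exists>g. adjoint_maps L L' f g \<and> adjoint_maps L' L g f')"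

lemma doubly_residuated_iff: "doubly_residuated L L' f \<longleftrightarrow> (\<exists>f'. double_adjoint L L' f f')"
  by (auto simp: doubly_residuated_def double_adjoint_def)

lemma doubly_residual_iff: "doubly_residual L L' f' \<longleftrightarrow> (\<exists>f. double_adjoint L L' f f')"
  by (auto simp: doubly_residual_def double_adjoint_def)

text \<open>The second component prescribed by the identification of doubly residuated maps is thus
  the far end of the chain.\<close>

lemma the_upper_adjoint_twice:
  fixes L :: "'x gorder" and L' :: "'y gorder"
  assumes "complete_lattice L" "complete_lattice L'" "double_adjoint L L' f f'"
  shows "the_upper_adjoint L' L (the_upper_adjoint L L' f) = restrict f' (carrier L)"
  using assms
  by (auto simp: double_adjoint_def the_upper_adjoint_eq adjoint_maps_restrict
      intro!: the_upper_adjoint_eq)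

lemma the_lower_adjoint_twice:
  fixes L :: "'x gorder" and L' :: "'y gorder"
  assumes "complete_lattice L" "complete_lattice L'" "double_adjoint L L' f f'"
  shows "the_lower_adjoint L' L (the_lower_adjoint L L' f') = restrict f (carrier L)"
  using assms
  by (auto simp: double_adjoint_def the_lower_adjoint_eq adjoint_maps_restrict
      intro!: the_lower_adjoint_eq)

lemma double_adjoint_restrict:
  fixes L :: "'x gorder" and L' :: "'y gorder"
  assumes "complete_lattice L" "complete_lattice L'"
  shows "double_adjoint L L' (restrict f (carrier L)) f' \<longleftrightarrow> double_adjoint L L' f f'"
    "double_adjoint L L' f (restrict f' (carrier L)) \<longleftrightarrow> double_adjoint L L' f f'"
  using assms by (simp_all add: double_adjoint_def adjoint_maps_restrict)

lemma double_adjoint_imp_funcset: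
  fixes L :: "'x gorder" and L' :: "'y gorder"
  assumes "complete_lattice L" "complete_lattice L'" "double_adjoint L L' f f'"
  shows "f \<in> carrier L \<rightarrow> carrier L'" "f' \<in> carrier L \<rightarrow> carrier L'"
  using assms by (auto simp: double_adjoint_def adjoint_maps_iff)

text \<open>The witness a is the value of the middle map at b. Sharing one a between both
  equivalences is what makes f and f' adjoint to the same map, and it matches concept continuity,
  where both preimages must come from one concept.\<close>

lemma double_adjoint_iff:
  fixes L :: "'x gorder" and L' :: "'y gorder"
  assumes "complete_lattice L" "complete_lattice L'"
    and "f \<in> carrier L \<rightarrow> carrier L'" "f' \<in> carrier L \<rightarrow> carrier L'"
  shows "double_adjoint L L' f f' \<longleftrightarrow> (\<forall>b\<in>carrier L'. \<exists>a\<in>carrier L. \<forall>x\<in>carrier L.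
    (f x \<sqsubseteq>\<^bsub>L'\<^esub> b \<longleftrightarrow> x \<sqsubseteq>\<^bsub>L\<^esub> a) \<and> (b \<sqsubseteq>\<^bsub>L'\<^esub> f' x \<longleftrightarrow> a \<sqsubseteq>\<^bsub>L\<^esub> x))"
    (is "_ \<longleftrightarrow> (\<forall>b\<in>_. \<exists>a\<in>_. ?P a b)")
proof -
  have "(\<forall>b\<in>carrier L'. \<exists>a\<in>carrier L. ?P a b) \<longleftrightarrow>
      (\<exists>g. \<forall>b\<in>carrier L'. g b \<in> carrier L \<and> ?P (g b) b)"
    \<comment> \<open>The middle map arises by choosing an a for every b.\<close>
    by (simp only: Bex_def) (rule bchoice_iff)
  also have "\<dots> \<longleftrightarrow> double_adjoint L L' f f'"
    unfolding double_adjoint_def using assms by (intro ex_cong1) (auto simp: adjoint_maps_iff)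
  finally show ?thesis by simp
qed

lemma double_adjoint_id:
  fixes L :: "'x gorder"
  assumes "complete_lattice L"
  shows "double_adjoint L L (restrict id (carrier L)) (restrict id (carrier L))"
  using assms by (auto simp: double_adjoint_iff)

text \<open>The middle maps compose in the opposite order, u after v. Closure of both starred
  families under composition and functoriality of \<open>identify\<close> come from this one
  chain.\<close>

lemma double_adjoint_compose:
  fixes L1 :: "'x gorder" and L2 :: "'y gorder" and L3 :: "'z gorder"
  assumes L: "complete_lattice L1" "complete_lattice L2" "complete_lattice L3"
    and "double_adjoint L1 L2 f f'" "double_adjoint L2 L3 g g'"
  shows "double_adjoint L1 L3 (compose (carrier L1) g f) (compose (carrier L1) g' f')"
proof -
  obtain u where u: "adjoint_maps L1 L2 f u" "adjoint_maps L2 L1 u f'"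
    using assms(4) by (auto simp: double_adjoint_def)
  obtain v where v: "adjoint_maps L2 L3 g v" "adjoint_maps L3 L2 v g'"
    using assms(5) by (auto simp: double_adjoint_def)
  have "adjoint_maps L1 L3 (compose (carrier L1) g f) (u \<circ> v)"
    "adjoint_maps L3 L1 (u \<circ> v) (compose (carrier L1) g' f')"
    using u v by (auto simp: adjoint_maps_iff L compose_def Pi_iff)
  then show ?thesis
    by (auto simp: double_adjoint_def)
qed

text \<open>If \<open>f\<close> is lower and \<open>f'\<close> is upper adjoint to \<open>g\<close>, surjectivity of either of them means
  injectivity of \<open>g\<close>, and injectivity of either means surjectivity of \<open>g\<close>.\<close>

lemma double_adjoint_surj_iff:
  fixes L :: "'x gorder" and L' :: "'y gorder"
  assumes L: "complete_lattice L" "complete_lattice L'" and d: "double_adjoint L L' f f'"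
  shows "f ` carrier L = carrier L' \<longleftrightarrow> f' ` carrier L = carrier L'"
proof -
  interpret L: complete_lattice L by fact
  interpret L': complete_lattice L' by fact
  obtain g where g: "adjoint_maps L L' f g" "adjoint_maps L' L g f'"
    using d by (auto simp: double_adjoint_def)
  interpret fg: galois_connection "\<lparr>orderA = L, orderB = L', lower = f, upper = g\<rparr>"
    using g(1) by (simp add: adjoint_maps_def)
  interpret gf': galois_connection "\<lparr>orderA = L', orderB = L, lower = g, upper = f'\<rparr>"
    using g(2) by (simp add: adjoint_maps_def)
  have typed: "\<And>x. x \<in> carrier L \<Longrightarrow> f x \<in> carrier L'" "\<And>x. x \<in> carrier L \<Longrightarrow> f' x \<in> carrier L'"
    "\<And>y. y \<in> carrier L' \<Longrightarrow> g y \<in> carrier L"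
    using fg.lower_closed fg.upper_closed gf'.upper_closed by simp_all
  have fgf: "f (g (f x)) = f x" "g (f' (g y)) = g y" "g (f (g y)) = g y" "f' (g (f' x)) = f' x"
    if "x \<in> carrier L" "y \<in> carrier L'" for x y
    using fg.lower_comp fg.upper_comp gf'.lower_comp gf'.upper_comp that by simp_all
  show ?thesis
  proof
    assume f: "f ` carrier L = carrier L'"
    have "f' (g y) = y" if y: "y \<in> carrier L'" for y
      using fgf y f typed by (metis imageE)
    then have "carrier L' \<subseteq> f' ` carrier L"
      using typed(3) by (metis imageI subsetI)
    then show "f' ` carrier L = carrier L'"
      using typed by blast
  next
    assume f': "f' ` carrier L = carrier L'"
    have "f (g y) = y" if y: "y \<in> carrier L'" for y
      using fgf y f' typed by (metis imageE)
    then have "carrier L' \<subseteq> f ` carrier L"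
      using typed(3) by (metis imageI subsetI)
    then show "f ` carrier L = carrier L'"
      using typed by blast
  qed
qed

text \<open>The mixed inequality f x \<le> f' y, which is the embedding condition between complete
  contexts, can be moved across either adjunction. It then says that g (f x) = x for all x, or
  equally that g (f' x) = x, and by f g f = f and f' g f' = f' this is injectivity of f or of
  f'.\<close>

lemma double_adjoint_inj_iff:
  fixes L :: "'x gorder" and L' :: "'y gorder"
  assumes L: "complete_lattice L" "complete_lattice L'" and d: "double_adjoint L L' f f'"
  shows "inj_on f (carrier L) \<longleftrightarrow>
      (\<forall>x\<in>carrier L. \<forall>y\<in>carrier L. x \<sqsubseteq>\<^bsub>L\<^esub> y \<longleftrightarrow> f x \<sqsubseteq>\<^bsub>L'\<^esub> f' y)" (is "_ \<longleftrightarrow> ?emb")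
    and "inj_on f' (carrier L) \<longleftrightarrow>
      (\<forall>x\<in>carrier L. \<forall>y\<in>carrier L. x \<sqsubseteq>\<^bsub>L\<^esub> y \<longleftrightarrow> f x \<sqsubseteq>\<^bsub>L'\<^esub> f' y)"
proof -
  interpret L: complete_lattice L by fact
  interpret L': complete_lattice L' by fact
  obtain g where g: "adjoint_maps L L' f g" "adjoint_maps L' L g f'"
    using d by (auto simp: double_adjoint_def)
  interpret fg: galois_connection "\<lparr>orderA = L, orderB = L', lower = f, upper = g\<rparr>"
    using g(1) by (simp add: adjoint_maps_def)
  interpret gf': galois_connection "\<lparr>orderA = L', orderB = L, lower = g, upper = f'\<rparr>"
    using g(2) by (simp add: adjoint_maps_def)
  have typed: "\<And>x. x \<in> carrier L \<Longrightarrow> f x \<in> carrier L'" "\<And>x. x \<in> carrier L \<Longrightarrow> f' x \<in> carrier L'"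
    "\<And>y. y \<in> carrier L' \<Longrightarrow> g y \<in> carrier L"
    using fg.lower_closed fg.upper_closed gf'.upper_closed by simp_all
  have fgf: "f (g (f x)) = f x" "f' (g (f' x)) = f' x" if "x \<in> carrier L" for x
    using fg.lower_comp gf'.upper_comp that by simp_all
  have adj: "g (f x) \<sqsubseteq>\<^bsub>L\<^esub> y \<longleftrightarrow> f x \<sqsubseteq>\<^bsub>L'\<^esub> f' y" "x \<sqsubseteq>\<^bsub>L\<^esub> g (f' y) \<longleftrightarrow> f x \<sqsubseteq>\<^bsub>L'\<^esub> f' y"
    if "x \<in> carrier L" "y \<in> carrier L" for x y
    using fg.galois_property gf'.galois_property typed that by simp_all
  have "?emb \<longleftrightarrow> (\<forall>x\<in>carrier L. g (f x) = x)"
    using adj(1) typed by (metis L.eqI_above)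
  also have "\<dots> \<longleftrightarrow> inj_on f (carrier L)"
    using fgf(1) typed by (metis inj_on_def)
  finally show "inj_on f (carrier L) \<longleftrightarrow> ?emb" by simp
  have "?emb \<longleftrightarrow> (\<forall>x\<in>carrier L. g (f' x) = x)"
    using adj(2) typed by (metis L.eqI_below)
  also have "\<dots> \<longleftrightarrow> inj_on f' (carrier L)"
    using fgf(2) typed by (metis inj_on_def)
  finally show "inj_on f' (carrier L) \<longleftrightarrow> ?emb" by simp
qed


section \<open>Categories of complete lattices\<close>

lemma sup_pres_id:
  fixes L :: "'x gorder"
  assumes "complete_lattice L"
  shows "sup_pres L L (restrict id (carrier L))"
proof -
  interpret complete_lattice L by fact
  have "restrict id (carrier L) (\<Squnion>\<^bsub>L\<^esub>A) = \<Squnion>\<^bsub>L\<^esub>(restrict id (carrier L) ` A)"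
    if "A \<subseteq> carrier L" for A
    unfolding restrict_id_image[OF that] using that by simp
  then show ?thesis
    unfolding sup_pres_def using assms by blast
qed

lemma inf_pres_id:
  fixes L :: "'x gorder"
  assumes "complete_lattice L"
  shows "inf_pres L L (restrict id (carrier L))"
  using sup_pres_id[OF complete_lattice_dual[OF assms]]
  unfolding sup_pres_dual by simp

lemma sup_pres_compose:
  fixes L :: "'x gorder" and L' :: "'y gorder" and L'' :: "'z gorder"
  assumes "f \<in> carrier L \<rightarrow> carrier L'" "sup_pres L L' f" "sup_pres L' L'' g"
  shows "sup_pres L L'' (compose (carrier L) g f)"
proof -
  interpret complete_lattice L
    using assms(2) by (simp add: sup_pres_def)
  have "compose (carrier L) g f (\<Squnion>\<^bsub>L\<^esub>A) = \<Squnion>\<^bsub>L''\<^esub>(compose (carrier L) g f ` A)"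
    if A: "A \<subseteq> carrier L" for A
  proof -
    have "f ` A \<subseteq> carrier L'"
      using A assms(1) by auto
    then show ?thesis
      using A assms(2,3) by (simp add: sup_pres_def compose_eq image_compose)
  qed
  then show ?thesis
    using assms(2,3) unfolding sup_pres_def by blast
qed

lemma inf_pres_compose:
  fixes L :: "'x gorder" and L' :: "'y gorder" and L'' :: "'z gorder"
  assumes "f \<in> carrier L \<rightarrow> carrier L'" "inf_pres L L' f" "inf_pres L' L'' g"
  shows "inf_pres L L'' (compose (carrier L) g f)"
  using sup_pres_compose[of f "inv_gorder L" "inv_gorder L'" "inv_gorder L''" g] assms
  unfolding sup_pres_dual by simp

lemma lattice_homE:
  assumes "h \<in> lattice_hom D L L'"
  obtains f f' where "D = CLjm" "h = Pair f f'" "f \<in> carrier L \<rightarrow>\<^sub>E carrier L'"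
      "f' \<in> carrier L \<rightarrow>\<^sub>E carrier L'" "sup_pres L L' f" "inf_pres L L' f'"
  | f where "D \<noteq> CLjm" "h = Single f" "f \<in> carrier L \<rightarrow>\<^sub>E carrier L'" "single_mor D L L' f"
  using assms by (auto simp: lattice_hom_def split: if_splits)

lemma single_mor_id:
  fixes L :: "'x gorder"
  assumes "complete_lattice L" "D \<noteq> CLjm"
  shows "single_mor D L L (restrict id (carrier L))"
proof -
  interpret complete_lattice L by fact
  let ?id = "restrict id (carrier L)"
  have 1: "complete_hom L L ?id"
    using assms by (simp add: complete_hom_def sup_pres_id inf_pres_id)
  have 2: "double_adjoint L L ?id ?id"
    using assms by (simp add: double_adjoint_id)
  have 3: "?id ` carrier L = carrier L"
    by (rule restrict_id_image) simp
  have 4: "inj_on ?id (carrier L)"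
    by (simp add: inj_on_def)
  have 5: "order_emb L L ?id"
    by (simp add: order_emb_def weak_partial_order_axioms)
  show ?thesis
    using assms(2) 1 2 3 4 5
    by (cases D) (auto simp: doubly_residuated_iff doubly_residual_iff bij_betw_def)
qed

lemma lattice_id_in_lattice_hom:
  fixes L :: "'x gorder"
  assumes "complete_lattice L"
  shows "lattice_id D L \<in> lattice_hom D L L"
  using assms by (auto simp: lattice_id_def lattice_hom_def sup_pres_id inf_pres_id single_mor_id)

lemma single_mor_compose:
  fixes L1 :: "'x gorder" and L2 :: "'y gorder" and L3 :: "'z gorder"
  assumes L: "complete_lattice L1" "complete_lattice L2" "complete_lattice L3"
    and f: "f \<in> carrier L1 \<rightarrow>\<^sub>E carrier L2" "single_mor D L1 L2 f"
    and g: "single_mor D L2 L3 g"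
  shows "single_mor D L1 L3 (compose (carrier L1) g f)"
proof -
  let ?gf = "compose (carrier L1) g f"
  have typed: "f x \<in> carrier L2" if "x \<in> carrier L1" for x
    using f(1) that by blast
  have 1: "complete_hom L1 L3 ?gf" if "complete_hom L1 L2 f" "complete_hom L2 L3 g"
    using that f(1)
    by (auto simp: complete_hom_def intro: sup_pres_compose inf_pres_compose)
  have 2: "doubly_residuated L1 L3 ?gf" if "doubly_residuated L1 L2 f" "doubly_residuated L2 L3 g"
    using that double_adjoint_compose[OF L] unfolding doubly_residuated_iff by blast
  have 3: "doubly_residual L1 L3 ?gf" if "doubly_residual L1 L2 f" "doubly_residual L2 L3 g"
    using that double_adjoint_compose[OF L] unfolding doubly_residual_iff by blast
  have 4: "?gf ` carrier L1 = carrier L3" if "f ` carrier L1 = carrier L2" "g ` carrier L2 = carrier L3"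
    using that by (simp add: image_compose)
  have 5: "inj_on ?gf (carrier L1)" if "inj_on f (carrier L1)" "inj_on g (carrier L2)"
    using that typed by (auto simp: inj_on_def compose_eq)
  have 6: "order_emb L1 L3 ?gf" if "order_emb L1 L2 f" "order_emb L2 L3 g"
    using that typed by (auto simp: order_emb_def compose_eq)
  show ?thesis
    using f(2) g 1 2 3 4 5 6 by (cases D) (simp_all add: bij_betw_def)
qed

lemma lattice_comp_in_lattice_hom:
  fixes L1 :: "'x gorder" and L2 :: "'y gorder" and L3 :: "'z gorder"
  assumes L: "complete_lattice L1" "complete_lattice L2" "complete_lattice L3"
    and h: "h \<in> lattice_hom D L1 L2" and k: "k \<in> lattice_hom D L2 L3"
  shows "lattice_comp L1 k h \<in> lattice_hom D L1 L3"
proof -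
  have typed: "compose (carrier L1) g f \<in> carrier L1 \<rightarrow>\<^sub>E carrier L3"
    if "f \<in> carrier L1 \<rightarrow>\<^sub>E carrier L2" "g \<in> carrier L2 \<rightarrow>\<^sub>E carrier L3" for f g
    using that by (auto simp: compose_def PiE_iff)
  show ?thesis
    using h
  proof (cases rule: lattice_homE)
    case (1 f f')
    with k obtain g g' where "k = Pair g g'" "g \<in> carrier L2 \<rightarrow>\<^sub>E carrier L3"
      "g' \<in> carrier L2 \<rightarrow>\<^sub>E carrier L3" "sup_pres L2 L3 g" "inf_pres L2 L3 g'"
      by (auto elim: lattice_homE)
    then show ?thesis
      using 1 typed by (auto simp: lattice_hom_def PiE_iff intro!: sup_pres_compose inf_pres_compose)
  next
    case (2 f)
    with k obtain g where "k = Single g" "g \<in> carrier L2 \<rightarrow>\<^sub>E carrier L3" "single_mor D L2 L3 g"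
      by (auto elim: lattice_homE)
    then show ?thesis
      using 2 typed single_mor_compose[OF L] by (simp add: lattice_hom_def)
  qed
qed

lemma lattice_comp_id:
  assumes "h \<in> lattice_hom D L L'"
  shows "lattice_comp L h (lattice_id D L) = h" "lattice_comp L (lattice_id D L') h = h"
  using assms
  by (auto elim!: lattice_homE simp: lattice_id_def compose_restrict_id restrict_id_compose)

lemma lattice_comp_assoc:
  assumes "h \<in> lattice_hom D L1 L2" "k \<in> lattice_hom D L2 L3" "l \<in> lattice_hom D L3 L4"
  shows "lattice_comp L1 l (lattice_comp L1 k h) = lattice_comp L1 (lattice_comp L2 l k) h"
  using assms by (auto elim!: lattice_homE simp: PiE_iff intro!: compose_assoc)

lemma lattice_category: "lattice_category D T1 T2 T3 T4"
  unfolding lattice_category_def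
  by (intro allI impI conjI ballI; elim conjE)
    (rule lattice_id_in_lattice_hom lattice_comp_id lattice_comp_in_lattice_hom lattice_comp_assoc,
      assumption+)+


section \<open>Morphisms between complete contexts\<close>

locale two_complete_lattices =
  L: gorder_complete_lattice L + L': gorder_complete_lattice L'
  for L :: "'x gorder" and L' :: "'y gorder"
begin

abbreviation "cc \<equiv> complete_context L"
abbreviation "cc' \<equiv> complete_context L'"

lemma complete: "complete_lattice L" "complete_lattice L'"
  by (rule L.complete_lattice_axioms L'.complete_lattice_axioms)+

lemma mapping_pairs_cc_iff:
  "(f, f') \<in> mapping_pairs cc cc' \<longleftrightarrow>
    f \<in> carrier L \<rightarrow>\<^sub>E carrier L' \<and> f' \<in> carrier L \<rightarrow>\<^sub>E carrier L'"
  by (simp add: mapping_pairs_iff)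

context
  fixes f f' assumes typed: "f \<in> carrier L \<rightarrow>\<^sub>E carrier L'" "f' \<in> carrier L \<rightarrow>\<^sub>E carrier L'"
begin

lemma mapping_pair: "(f, f') \<in> mapping_pairs cc cc'"
  using typed by (simp add: mapping_pairs_cc_iff)

lemma funcset: "f \<in> carrier L \<rightarrow> carrier L'" "f' \<in> carrier L \<rightarrow> carrier L'"
  using typed by auto

lemma image_subset:
  "A \<subseteq> carrier L \<Longrightarrow> f ` A \<subseteq> carrier L'" "A \<subseteq> carrier L \<Longrightarrow> f' ` A \<subseteq> carrier L'"
  using typed by auto

text \<open>Preimages of principal ideals under f have to be principal ideals, so f is residuated
  and thus preserves joins; principal filters give the dual statement for f'.\<close>

lemma separately_continuous_iff:
  "separately_continuous cc cc' (f, f') \<longleftrightarrow> sup_pres L L' f \<and> inf_pres L L' f'"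
proof -
  have "{x \<in> carrier L. f x \<sqsubseteq>\<^bsub>L'\<^esub> b} = down_set L a \<longleftrightarrow>
      (\<forall>x\<in>carrier L. f x \<sqsubseteq>\<^bsub>L'\<^esub> b \<longleftrightarrow> x \<sqsubseteq>\<^bsub>L\<^esub> a)"
    "{x \<in> carrier L. b \<sqsubseteq>\<^bsub>L'\<^esub> f' x} = up_set L a \<longleftrightarrow>
      (\<forall>x\<in>carrier L. b \<sqsubseteq>\<^bsub>L'\<^esub> f' x \<longleftrightarrow> a \<sqsubseteq>\<^bsub>L\<^esub> x)" for a b
    by (auto simp: down_set_def up_set_def)
  then show ?thesis
    unfolding L'.separately_continuous_complete_context_iff[OF mapping_pair]
      sup_pres_iff_residuated[OF complete funcset(1)] inf_pres_iff_residual[OF complete funcset(2)]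
      L.extents_complete_context L.intents_complete_context
    by (simp add: image_iff ball_conj_distrib)
qed

text \<open>The ideal obtained from f and the filter obtained from f' must be generated by the same
  element, namely the value of the middle map.\<close>

lemma concept_continuous_iff:
  "concept_continuous cc cc' (f, f') \<longleftrightarrow> double_adjoint L L' f f'"
proof -
  have "{x \<in> carrier L. f x \<sqsubseteq>\<^bsub>L'\<^esub> b} = down_set L a \<and>
      {x \<in> carrier L. b \<sqsubseteq>\<^bsub>L'\<^esub> f' x} = up_set L a \<longleftrightarrow>
      (\<forall>x\<in>carrier L. (f x \<sqsubseteq>\<^bsub>L'\<^esub> b \<longleftrightarrow> x \<sqsubseteq>\<^bsub>L\<^esub> a) \<and> (b \<sqsubseteq>\<^bsub>L'\<^esub> f' x \<longleftrightarrow> a \<sqsubseteq>\<^bsub>L\<^esub> x))" for a b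
    by (auto simp: down_set_def up_set_def)
  then show ?thesis
    unfolding L'.concept_continuous_complete_context_iff[OF mapping_pair]
      double_adjoint_iff[OF complete funcset] L.concepts_complete_context
    by (simp add: image_iff)
qed

text \<open>The concept of a is sent to a concept iff the join of f over the ideal of a equals the
  meet of f' over its filter. With preservation of joins and meets these are f a and f' a.\<close>

lemma conceptual_iff:
  "conceptual cc cc' (f, f') \<longleftrightarrow> complete_hom L L' f \<and> f' = f"
proof -
  have "(down cc' (f' ` up_set L a), up cc' (f ` down_set L a)) \<in> concepts cc' \<longleftrightarrow> f a = f' a"
    if "a \<in> carrier L" "sup_pres L L' f" "inf_pres L L' f'" for a
  proof -
    have "\<Squnion>\<^bsub>L'\<^esub>(f ` down_set L a) = f a" "\<Sqinter>\<^bsub>L'\<^esub>(f' ` up_set L a) = f' a"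
      using that L.sup_down_set[of a] L.inf_up_set[of a] L.down_set_subset[of a] L.up_set_subset[of a]
      unfolding sup_pres_def inf_pres_def by metis+
    then show ?thesis
      by (simp add: L'.down_up_in_concepts_iff image_subset L.down_set_subset L.up_set_subset)
  qed
  then have "conceptual cc cc' (f, f') \<longleftrightarrow>
      sup_pres L L' f \<and> inf_pres L L' f' \<and> (\<forall>a\<in>carrier L. f a = f' a)"
    unfolding conceptual_def split_conv separately_continuous_iff L.concepts_complete_context
    by auto
  also have "\<dots> \<longleftrightarrow> sup_pres L L' f \<and> inf_pres L L' f' \<and> f' = f"
    using typed by (metis PiE_ext)
  also have "\<dots> \<longleftrightarrow> complete_hom L L' f \<and> f' = f"
    by (auto simp: complete_hom_def)
  finally show ?thesis .
qed

lemma surj_imp_dense_pair: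
  assumes "f ` carrier L = carrier L'" "f' ` carrier L = carrier L'"
  shows "dense_pair cc cc' (f, f')"
  unfolding dense_pair_def split_conv
  using assms by (metis objects_complete_context attributes_complete_context subset_image_iff)

text \<open>Density at the singleton {y} makes y a join of some f[A], hence the f-image of the join
  of A; dually for f'.\<close>

lemma dense_pair_imp_surj:
  assumes "sup_pres L L' f" "inf_pres L L' f'" "dense_pair cc cc' (f, f')"
  shows "f ` carrier L = carrier L'" "f' ` carrier L = carrier L'"
proof -
  have "y \<in> f ` carrier L" if y: "y \<in> carrier L'" for y
  proof -
    obtain A where A: "A \<subseteq> carrier L" "down cc' (up cc' {y}) = down cc' (up cc' (f ` A))"
      using dense_pairD(1)[OF assms(3), of "{y}"] y by auto
    have "f ` A \<subseteq> carrier L'"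
      using A image_subset by simp
    then have "down_set L' y = down_set L' (\<Squnion>\<^bsub>L'\<^esub>(f ` A))"
      using A y by (simp add: L'.up_complete_context L'.down_up_set)
    then have "y = f (\<Squnion>\<^bsub>L\<^esub>A)"
      using y A assms(1) \<open>f ` A \<subseteq> carrier L'\<close> by (simp add: L'.down_set_inject sup_pres_def)
    then show ?thesis
      using A by simp
  qed
  then show "f ` carrier L = carrier L'"
    using funcset by blast
  have "y \<in> f' ` carrier L" if y: "y \<in> carrier L'" for y
  proof -
    obtain A where A: "A \<subseteq> carrier L" "up cc' (down cc' {y}) = up cc' (down cc' (f' ` A))"
      using dense_pairD(2)[OF assms(3), of "{y}"] y by auto
    have "f' ` A \<subseteq> carrier L'"
      using A image_subset by simp
    then have "up_set L' y = up_set L' (\<Sqinter>\<^bsub>L'\<^esub>(f' ` A))"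
      using A y by (simp add: L'.down_complete_context L'.up_down_set)
    then have "y = f' (\<Sqinter>\<^bsub>L\<^esub>A)"
      using y A assms(2) \<open>f' ` A \<subseteq> carrier L'\<close> by (simp add: L'.up_set_inject inf_pres_def)
    then show ?thesis
      using A by simp
  qed
  then show "f' ` carrier L = carrier L'"
    using funcset by blast
qed

lemma embedding_iff:
  "embedding cc cc' (f, f') \<longleftrightarrow>
    (\<forall>x\<in>carrier L. \<forall>y\<in>carrier L. x \<sqsubseteq>\<^bsub>L\<^esub> y \<longleftrightarrow> f x \<sqsubseteq>\<^bsub>L'\<^esub> f' y)"
  using funcset by (auto simp: embedding_def Pi_iff)

text \<open>The inequality x \<le> y is an equation between joins, which f preserves and, when
  injective, reflects. Conversely an embedding yields injectivity by antisymmetry.\<close>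

lemma complete_hom_inj_iff:
  assumes "complete_hom L L' f"
  shows "inj_on f (carrier L) \<longleftrightarrow> embedding cc cc' (f, f)"
proof -
  have carrier: "f x \<in> carrier L'" if "x \<in> carrier L" for x
    using funcset that by auto
  have le: "f x \<sqsubseteq>\<^bsub>L'\<^esub> f y \<longleftrightarrow> f (\<Squnion>\<^bsub>L\<^esub>{x, y}) = f y" if "x \<in> carrier L" "y \<in> carrier L" for x y
    using assms that carrier by (simp add: L'.le_iff_sup_eq complete_hom_def sup_pres_def)
  show ?thesis
  proof
    assume "inj_on f (carrier L)"
    then have "x \<sqsubseteq>\<^bsub>L\<^esub> y \<longleftrightarrow> f x \<sqsubseteq>\<^bsub>L'\<^esub> f y" if "x \<in> carrier L" "y \<in> carrier L" for x y
      using that by (simp add: le L.le_iff_sup_eq inj_on_eq_iff)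
    then show "embedding cc cc' (f, f)"
      using carrier by (simp add: embedding_def)
  next
    assume "embedding cc cc' (f, f)"
    then have emb: "x \<sqsubseteq>\<^bsub>L\<^esub> y \<longleftrightarrow> f x \<sqsubseteq>\<^bsub>L'\<^esub> f y" if "x \<in> carrier L" "y \<in> carrier L" for x y
      using that carrier by (simp add: embedding_def)
    show "inj_on f (carrier L)"
    proof (rule inj_onI)
      fix x y assume "x \<in> carrier L" "y \<in> carrier L" "f x = f y"
      then show "x = y"
        using emb[of x y] emb[of y x] carrier by (intro L.le_antisym) simp_all
    qed
  qed
qed

text \<open>Density and embedding together give separate continuity, so f preserves joins and f'
  meets, and density then makes both surjective. The remaining point is that the two components
  coincide.\<close>

lemma dense_embedding_iff:
  "dense_pair cc cc' (f, f') \<and> embedding cc cc' (f, f') \<longleftrightarrow>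
    order_emb L L' f \<and> bij_betw f (carrier L) (carrier L') \<and> f' = f"
proof
  have carrier: "f x \<in> carrier L'" "f' x \<in> carrier L'" if "x \<in> carrier L" for x
    using funcset that by auto
  {
    assume *: "dense_pair cc cc' (f, f') \<and> embedding cc cc' (f, f')"
    then have pres: "sup_pres L L' f" "inf_pres L L' f'"
      using dense_embedding_imp_separately_continuous[OF mapping_pair]
      by (simp_all add: separately_continuous_iff)
    then have surj: "f ` carrier L = carrier L'" "f' ` carrier L = carrier L'"
      using dense_pair_imp_surj * by blast+
    have emb: "f x \<sqsubseteq>\<^bsub>L'\<^esub> f' y \<longleftrightarrow> x \<sqsubseteq>\<^bsub>L\<^esub> y" if "x \<in> carrier L" "y \<in> carrier L" for x y
      using * that by (simp add: embedding_iff)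
    \<comment> \<open>Reflexivity and the embedding property give f y \<le> f' y, which turns a
      bound by f y into one by f' y.\<close>
    have f_reflects: "x \<sqsubseteq>\<^bsub>L\<^esub> y" if "x \<in> carrier L" "y \<in> carrier L" "f x \<sqsubseteq>\<^bsub>L'\<^esub> f y" for x y
      using that emb[of y y] emb[of x y] L'.le_trans[of "f x" "f y" "f' y"] carrier by simp
    have f_mono: "f x \<sqsubseteq>\<^bsub>L'\<^esub> f y" if "x \<in> carrier L" "y \<in> carrier L" "x \<sqsubseteq>\<^bsub>L\<^esub> y" for x y
    proof -
      have "f (\<Squnion>\<^bsub>L\<^esub>{x, y}) = \<Squnion>\<^bsub>L'\<^esub>{f x, f y}"
        using pres(1) that by (simp add: sup_pres_def)
      then show ?thesis
        using that carrier by (simp add: L.le_iff_sup_eq L'.le_iff_sup_eq)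
    qed
    \<comment> \<open>Surjectivity of f provides z with f z = f' y. The embedding property gives z
      \<le> y, so f' y = f z \<le> f y by monotonicity; the other inequality is the embedding
      property at y, y.\<close>
    have "f' y = f y" if y: "y \<in> carrier L" for y
    proof -
      obtain z where z: "z \<in> carrier L" "f' y = f z"
        using surj(1) carrier(2)[OF y] by (metis imageE)
      then have "f z \<sqsubseteq>\<^bsub>L'\<^esub> f' y"
        using carrier by simp
      then have "z \<sqsubseteq>\<^bsub>L\<^esub> y"
        using emb[of z y] y z by simp
      then have "f' y \<sqsubseteq>\<^bsub>L'\<^esub> f y"
        using f_mono z y by simp
      then show ?thesis
        using y carrier emb[of y y] by (intro L'.le_antisym) simp_all
    qed
    then have "f' = f"
      using typed by (metis PiE_ext)
    moreover have "order_emb L L' f"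
      using f_mono f_reflects
      by (auto simp: order_emb_def L.weak_partial_order_axioms L'.weak_partial_order_axioms)
    moreover have "inj_on f (carrier L)"
    proof (rule inj_onI)
      fix x y assume "x \<in> carrier L" "y \<in> carrier L" "f x = f y"
      then show "x = y"
        using f_reflects[of x y] f_reflects[of y x] carrier by (intro L.le_antisym) simp_all
    qed
    ultimately show "order_emb L L' f \<and> bij_betw f (carrier L) (carrier L') \<and> f' = f"
      using surj by (simp add: bij_betw_def)
  }
  assume "order_emb L L' f \<and> bij_betw f (carrier L) (carrier L') \<and> f' = f"
  then show "dense_pair cc cc' (f, f') \<and> embedding cc cc' (f, f')"
    using surj_imp_dense_pair embedding_iff by (auto simp: order_emb_def bij_betw_def)
qed

end

section \<open>Hom sets between complete contexts\<close>

lemma context_hom_eq_diagonal: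
  assumes "(D, C) \<in> {(CLc, Cc), (CLcd, Ccd), (CLce, Cce), (CLis, Cde)}"
  shows "context_hom C cc cc' = {(f, f) |f. f \<in> carrier L \<rightarrow>\<^sub>E carrier L' \<and> single_mor D L L' f}"
proof -
  have "(f, f') \<in> context_hom C cc cc' \<longleftrightarrow> f' = f \<and> single_mor D L L' f"
    if typed: "f \<in> carrier L \<rightarrow>\<^sub>E carrier L'" "f' \<in> carrier L \<rightarrow>\<^sub>E carrier L'" for f f'
  proof -
    have dense: "dense_pair cc cc' (f, f) \<longleftrightarrow> f ` carrier L = carrier L'" if "complete_hom L L' f"
      using surj_imp_dense_pair[OF typed(1) typed(1)] dense_pair_imp_surj[OF typed(1) typed(1)] that
      by (auto simp: complete_hom_def)
    show ?thesis
      using assms mapping_pair[OF typed] conceptual_iff[OF typed] dense_embedding_iff[OF typed]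
        complete_hom_inj_iff[OF typed(1) typed(1)] dense
      by (auto simp: context_hom_def)
  qed
  then show ?thesis
    by (auto simp: context_hom_def mapping_pairs_cc_iff)
qed

text \<open>Density and the embedding property involve both components, but along a chain of
  adjoints they reduce to surjectivity and injectivity of f alone.\<close>

lemma context_hom_eq_double_adjoint:
  assumes "(D, C) \<in> {(CLc_low, Ccc), (CLc_low_d, Cccd), (CLc_low_e, Ccce)}"
  shows "context_hom C cc cc' = {(f, f'). f \<in> carrier L \<rightarrow>\<^sub>E carrier L' \<and>
    f' \<in> carrier L \<rightarrow>\<^sub>E carrier L' \<and> double_adjoint L L' f f' \<and> single_mor D L L' f}"
proof -
  have "(f, f') \<in> context_hom C cc cc' \<longleftrightarrow> double_adjoint L L' f f' \<and> single_mor D L L' f"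
    if typed: "f \<in> carrier L \<rightarrow>\<^sub>E carrier L'" "f' \<in> carrier L \<rightarrow>\<^sub>E carrier L'" for f f'
  proof (cases "double_adjoint L L' f f'")
    case True
    then have cc: "concept_continuous cc cc' (f, f')" and res: "doubly_residuated L L' f"
      using concept_continuous_iff[OF typed] by (auto simp: doubly_residuated_iff)
    then have "sup_pres L L' f" "inf_pres L L' f'"
      using separately_continuous_iff[OF typed] concept_continuous_imp_separately_continuous by auto
    then have "dense_pair cc cc' (f, f') \<longleftrightarrow> f ` carrier L = carrier L'"
      using surj_imp_dense_pair[OF typed] dense_pair_imp_surj[OF typed]
        double_adjoint_surj_iff[OF complete True] by blast
    moreover have "embedding cc cc' (f, f') \<longleftrightarrow> inj_on f (carrier L)"
      unfolding embedding_iff[OF typed] double_adjoint_inj_iff(1)[OF complete True] ..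
    ultimately show ?thesis
      using assms True cc res mapping_pair[OF typed]
      by (auto simp: context_hom_def del: equalityI)
  next
    case False
    then show ?thesis
      using assms concept_continuous_iff[OF typed] by (auto simp: context_hom_def)
  qed
  then show ?thesis
    by (auto simp: context_hom_def mapping_pairs_cc_iff)
qed

text \<open>Moves the conditions from one end of the chain to the other, so that a hom set described
  through f can be read as one of doubly residual maps f'.\<close>

lemma single_mor_low_iff_upp:
  assumes "(D, D') \<in> {(CLc_low, CLc_upp), (CLc_low_d, CLc_upp_d), (CLc_low_e, CLc_upp_e)}"
    and d: "double_adjoint L L' f f'"
  shows "single_mor D L L' f \<longleftrightarrow> single_mor D' L L' f'"
proof -
  have "inj_on f (carrier L) \<longleftrightarrow> inj_on f' (carrier L)"
    using double_adjoint_inj_iff[OF complete d] by simp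
  moreover have "f ` carrier L = carrier L' \<longleftrightarrow> f' ` carrier L = carrier L'"
    using double_adjoint_surj_iff[OF complete d] .
  moreover have "doubly_residuated L L' f" "doubly_residual L L' f'"
    using d by (auto simp: doubly_residuated_iff doubly_residual_iff)
  ultimately show ?thesis
    using assms(1) by (auto del: equalityI)
qed

text \<open>The double upper adjoint is the restriction of f' to the carrier, and this is f' itself
  by extensionality.\<close>

lemma identify_low:
  assumes "D \<in> {CLc_low, CLc_low_d, CLc_low_e}" "double_adjoint L L' f f'"
    "f' \<in> carrier L \<rightarrow>\<^sub>E carrier L'"
  shows "identify D L L' (Single f) = (f, f')"
  using assms the_upper_adjoint_twice[OF complete assms(2)]
  by (auto simp: identify_single_def PiE_iff extensional_restrict)

lemma identify_upp:
  assumes "D \<in> {CLc_upp, CLc_upp_d, CLc_upp_e}" "double_adjoint L L' f f'"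
    "f \<in> carrier L \<rightarrow>\<^sub>E carrier L'"
  shows "identify D L L' (Single f') = (f, f')"
  using assms the_lower_adjoint_twice[OF complete assms(2)]
  by (auto simp: identify_single_def PiE_iff extensional_restrict)

lemma doubly_residuatedE:
  assumes "doubly_residuated L L' f"
  obtains f' where "f' \<in> carrier L \<rightarrow>\<^sub>E carrier L'" "double_adjoint L L' f f'"
proof -
  obtain f' where f': "double_adjoint L L' f f'"
    using assms by (auto simp: doubly_residuated_iff)
  then have "restrict f' (carrier L) \<in> carrier L \<rightarrow>\<^sub>E carrier L'"
    using double_adjoint_imp_funcset(2)[OF complete f'] by auto
  then show ?thesis
    using that f' double_adjoint_restrict(2)[OF complete] by blast
qed

lemma doubly_residualE:
  assumes "doubly_residual L L' f'"
  obtains f where "f \<in> carrier L \<rightarrow>\<^sub>E carrier L'" "double_adjoint L L' f f'"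
proof -
  obtain f where f: "double_adjoint L L' f f'"
    using assms by (auto simp: doubly_residual_iff)
  then have "restrict f (carrier L) \<in> carrier L \<rightarrow>\<^sub>E carrier L'"
    using double_adjoint_imp_funcset(1)[OF complete f] by auto
  then show ?thesis
    using that f double_adjoint_restrict(1)[OF complete] by blast
qed

end

definition corresponding_cats :: "(lattice_cat \<times> context_cat) set" where
  "corresponding_cats = {(CLjm, Cjm), (CLc, Cc), (CLcd, Ccd), (CLce, Cce), (CLis, Cde),
     (CLc_low, Ccc), (CLc_low_d, Cccd), (CLc_low_e, Ccce),
     (CLc_upp, Ccc), (CLc_upp_d, Cccd), (CLc_upp_e, Ccce)}"

text \<open>The cases are the kinds of identification: arbitrary pairs, diagonal pairs, pairs given
  by the lower end of a chain, and pairs given by its upper end. In the last one D' is the doubly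
  residuated partner of D.\<close>

lemma corresponding_catsE:
  assumes "(D, C) \<in> corresponding_cats"
  obtains "D = CLjm" "C = Cjm"
  | "(D, C) \<in> {(CLc, Cc), (CLcd, Ccd), (CLce, Cce), (CLis, Cde)}"
  | "(D, C) \<in> {(CLc_low, Ccc), (CLc_low_d, Cccd), (CLc_low_e, Ccce)}"
  | D' where "(D', C) \<in> {(CLc_low, Ccc), (CLc_low_d, Cccd), (CLc_low_e, Ccce)}"
    "(D', D) \<in> {(CLc_low, CLc_upp), (CLc_low_d, CLc_upp_d), (CLc_low_e, CLc_upp_e)}"
  using assms unfolding corresponding_cats_def by blast

section \<open>Faithfulness and fullness of the identification\<close>

context two_complete_lattices
begin

text \<open>Each map of a lattice morphism survives unchanged as a component of its image.\<close>

lemma inj_on_identify: "inj_on (identify D L L') (lattice_hom D L L')"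
  by (rule inj_onI) (auto elim!: lattice_homE simp: identify_single_def split: if_splits)

lemma identify_image:
  assumes "(D, C) \<in> corresponding_cats"
  shows "identify D L L' ` lattice_hom D L L' = context_hom C cc cc'"
  using assms
proof (cases rule: corresponding_catsE)
  case 1
  then have iff: "(f, f') \<in> context_hom C cc cc' \<longleftrightarrow> Pair f f' \<in> lattice_hom D L L'" for f f'
    using separately_continuous_iff
    by (auto simp: context_hom_def lattice_hom_def mapping_pairs_cc_iff)
  show ?thesis
  proof (intro subset_antisym subsetI)
    fix p assume "p \<in> identify D L L' ` lattice_hom D L L'"
    then obtain h where h: "h \<in> lattice_hom D L L'" "p = identify D L L' h"
      by blast
    obtain f f' where "h = Pair f f'"
      using h(1) 1(1) by (auto elim!: lattice_homE)
    with h show "p \<in> context_hom C cc cc'"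
      by (simp add: iff)
  next
    fix p assume "p \<in> context_hom C cc cc'"
    then have "Pair (fst p) (snd p) \<in> lattice_hom D L L'" "p = identify D L L' (Pair (fst p) (snd p))"
      by (simp_all flip: iff)
    then show "p \<in> identify D L L' ` lattice_hom D L L'"
      by blast
  qed
next
  case 2
  then have "D \<noteq> CLjm" "\<And>f. identify D L L' (Single f) = (f, f)"
    by (auto simp: identify_single_def)
  moreover from this(1) have "lattice_hom D L L' =
      Single ` {f \<in> carrier L \<rightarrow>\<^sub>E carrier L'. single_mor D L L' f}"
    by (auto simp: lattice_hom_def)
  ultimately show ?thesis
    unfolding context_hom_eq_diagonal[OF 2] by (auto simp: image_image simp del: identify.simps)
next
  case 3
  then have D: "D \<noteq> CLjm" "D \<in> {CLc_low, CLc_low_d, CLc_low_e}"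
    and res: "\<And>f. single_mor D L L' f \<Longrightarrow> doubly_residuated L L' f"
    by auto
  show ?thesis
    unfolding context_hom_eq_double_adjoint[OF 3]
  proof (intro subset_antisym subsetI)
    fix p assume "p \<in> identify D L L' ` lattice_hom D L L'"
    then obtain f where f: "f \<in> carrier L \<rightarrow>\<^sub>E carrier L'" "single_mor D L L' f"
      "p = identify D L L' (Single f)"
      using D(1) by (auto simp: lattice_hom_def)
    obtain f' where "f' \<in> carrier L \<rightarrow>\<^sub>E carrier L'" "double_adjoint L L' f f'"
      using doubly_residuatedE[OF res[OF f(2)]] .
    then show "p \<in> {(f, f'). f \<in> carrier L \<rightarrow>\<^sub>E carrier L' \<and> f' \<in> carrier L \<rightarrow>\<^sub>E carrier L' \<and>
        double_adjoint L L' f f' \<and> single_mor D L L' f}"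
      using f identify_low[OF D(2)] by simp
  next
    fix p assume "p \<in> {(f, f'). f \<in> carrier L \<rightarrow>\<^sub>E carrier L' \<and> f' \<in> carrier L \<rightarrow>\<^sub>E carrier L' \<and>
        double_adjoint L L' f f' \<and> single_mor D L L' f}"
    then obtain f f' where p: "p = (f, f')" "f \<in> carrier L \<rightarrow>\<^sub>E carrier L'"
      "f' \<in> carrier L \<rightarrow>\<^sub>E carrier L'" "double_adjoint L L' f f'" "single_mor D L L' f"
      by blast
    then have "p = identify D L L' (Single f)" "Single f \<in> lattice_hom D L L'"
      using identify_low[OF D(2)] D(1) by (simp_all add: lattice_hom_def)
    then show "p \<in> identify D L L' ` lattice_hom D L L'"
      by (rule image_eqI)
  qed
next
  \<comment> \<open>The hom set is known in terms of the lower end f and D'; the morphism sought is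
    the upper end f', with D.\<close>
  case (4 D')
  then have D: "D \<noteq> CLjm" "D \<in> {CLc_upp, CLc_upp_d, CLc_upp_e}"
    and res: "\<And>f. single_mor D L L' f \<Longrightarrow> doubly_residual L L' f"
    by auto
  show ?thesis
    unfolding context_hom_eq_double_adjoint[OF 4(1)]
  proof (intro subset_antisym subsetI)
    fix p assume "p \<in> identify D L L' ` lattice_hom D L L'"
    then obtain f' where f': "f' \<in> carrier L \<rightarrow>\<^sub>E carrier L'" "single_mor D L L' f'"
      "p = identify D L L' (Single f')"
      using D(1) by (auto simp: lattice_hom_def)
    obtain f where "f \<in> carrier L \<rightarrow>\<^sub>E carrier L'" "double_adjoint L L' f f'"
      using doubly_residualE[OF res[OF f'(2)]] .
    then show "p \<in> {(f, f'). f \<in> carrier L \<rightarrow>\<^sub>E carrier L' \<and> f' \<in> carrier L \<rightarrow>\<^sub>E carrier L' \<and>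
        double_adjoint L L' f f' \<and> single_mor D' L L' f}"
      using f' identify_upp[OF D(2)] single_mor_low_iff_upp[OF 4(2)] by simp
  next
    fix p assume "p \<in> {(f, f'). f \<in> carrier L \<rightarrow>\<^sub>E carrier L' \<and> f' \<in> carrier L \<rightarrow>\<^sub>E carrier L' \<and>
        double_adjoint L L' f f' \<and> single_mor D' L L' f}"
    then obtain f f' where p: "p = (f, f')" "f \<in> carrier L \<rightarrow>\<^sub>E carrier L'"
      "f' \<in> carrier L \<rightarrow>\<^sub>E carrier L'" "double_adjoint L L' f f'" "single_mor D' L L' f"
      by blast
    then have "p = identify D L L' (Single f')" "Single f' \<in> lattice_hom D L L'"
      using identify_upp[OF D(2)] D(1) single_mor_low_iff_upp[OF 4(2)]
      by (simp_all add: lattice_hom_def)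
    then show "p \<in> identify D L L' ` lattice_hom D L L'"
      by (rule image_eqI)
  qed
qed

lemma bij_betw_identify:
  "(D, C) \<in> corresponding_cats \<Longrightarrow>
    bij_betw (identify D L L') (lattice_hom D L L') (context_hom C cc cc')"
  by (simp add: bij_betw_def inj_on_identify identify_image)

end

lemma two_complete_lattices_iff:
  "two_complete_lattices L L' \<longleftrightarrow> complete_lattice L \<and> complete_lattice L'"
  by (simp add: two_complete_lattices_def gorder_complete_lattice_iff)

section \<open>Functoriality of the identification\<close>

lemma identify_id:
  fixes L :: "'x gorder"
  assumes "complete_lattice L"
  shows "identify D L L (lattice_id D L) = pair_id (complete_context L)"
proof -
  interpret two_complete_lattices L L
    using assms by (simp add: two_complete_lattices_iff)
  let ?id = "restrict id (carrier L)"
  have id: "?id \<in> carrier L \<rightarrow>\<^sub>E carrier L" "double_adjoint L L ?id ?id"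
    using double_adjoint_id[OF assms] by auto
  show ?thesis
    using identify_low[OF _ id(2,1), of D] identify_upp[OF _ id(2,1), of D]
    by (cases D) (simp_all add: pair_id_def lattice_id_def identify_single_def)
qed

text \<open>Taking adjoints reverses composition, and taking them twice restores the order. In the
  starred cases both factors are completed to chains, and the composite chain identifies the
  composite map.\<close>

lemma identify_comp:
  fixes L1 :: "'x gorder" and L2 :: "'y gorder" and L3 :: "'z gorder"
  assumes L: "complete_lattice L1" "complete_lattice L2" "complete_lattice L3"
    and h: "h \<in> lattice_hom D L1 L2" and k: "k \<in> lattice_hom D L2 L3"
  shows "identify D L1 L3 (lattice_comp L1 k h) =
    pair_comp (complete_context L1) (identify D L2 L3 k) (identify D L1 L2 h)"
proof -
  interpret L12: two_complete_lattices L1 L2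
    using L by (simp add: two_complete_lattices_iff)
  interpret L23: two_complete_lattices L2 L3
    using L by (simp add: two_complete_lattices_iff)
  interpret L13: two_complete_lattices L1 L3
    using L by (simp add: two_complete_lattices_iff)
  have typed: "compose (carrier L1) g f \<in> carrier L1 \<rightarrow>\<^sub>E carrier L3"
    if "f \<in> carrier L1 \<rightarrow>\<^sub>E carrier L2" "g \<in> carrier L2 \<rightarrow>\<^sub>E carrier L3" for f g
    using that by (auto simp: compose_def PiE_iff)
  show ?thesis
    using h
  proof (cases rule: lattice_homE)
    case (1 f f')
    with k show ?thesis
      by (auto elim!: lattice_homE simp: pair_comp_def)
  next
    case (2 f)
    with k obtain g where g: "k = Single g" "g \<in> carrier L2 \<rightarrow>\<^sub>E carrier L3" "single_mor D L2 L3 g"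
      by (auto elim: lattice_homE)
    consider "D \<in> {CLc_low, CLc_low_d, CLc_low_e}" | "D \<in> {CLc_upp, CLc_upp_d, CLc_upp_e}"
      | "D \<in> {CLc, CLcd, CLce, CLis}"
      using 2(1) by (cases D) auto
    then show ?thesis
    proof cases
      case D: 1
      have "doubly_residuated L1 L2 f" "doubly_residuated L2 L3 g"
        using D 2 g by auto
      then obtain f' g' where f': "f' \<in> carrier L1 \<rightarrow>\<^sub>E carrier L2" "double_adjoint L1 L2 f f'"
        and g': "g' \<in> carrier L2 \<rightarrow>\<^sub>E carrier L3" "double_adjoint L2 L3 g g'"
        by (metis L12.doubly_residuatedE L23.doubly_residuatedE)
      show ?thesis
        using L12.identify_low[OF D f'(2,1)] L23.identify_low[OF D g'(2,1)]
          L13.identify_low[OF D double_adjoint_compose[OF L f'(2) g'(2)] typed[OF f'(1) g'(1)]]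
        by (simp add: 2 g pair_comp_def)
    next
      case D: 2
      have "doubly_residual L1 L2 f" "doubly_residual L2 L3 g"
        using D 2 g by auto
      then obtain f' g' where f': "f' \<in> carrier L1 \<rightarrow>\<^sub>E carrier L2" "double_adjoint L1 L2 f' f"
        and g': "g' \<in> carrier L2 \<rightarrow>\<^sub>E carrier L3" "double_adjoint L2 L3 g' g"
        by (metis L12.doubly_residualE L23.doubly_residualE)
      show ?thesis
        using L12.identify_upp[OF D f'(2,1)] L23.identify_upp[OF D g'(2,1)]
          L13.identify_upp[OF D double_adjoint_compose[OF L f'(2) g'(2)] typed[OF f'(1) g'(1)]]
        by (simp add: 2 g pair_comp_def)
    next
      case 3
      then show ?thesis
        using 2 g by (auto simp: pair_comp_def identify_single_def)
    qed
  qed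
qed

lemma complete_context_eqD:
  assumes "complete_context L = complete_context L'"
  shows "carrier L = carrier L'"
    "x \<in> carrier L \<Longrightarrow> y \<in> carrier L \<Longrightarrow> x \<sqsubseteq>\<^bsub>L\<^esub> y \<longleftrightarrow> x \<sqsubseteq>\<^bsub>L'\<^esub> y"
  using arg_cong[OF assms, of objects] arg_cong[OF assms, of "\<lambda>K. (x, y) \<in> incidence K"]
  by simp_all

lemma full_subcategory:
  assumes "(D, C) \<in> corresponding_cats"
  shows "full_subcategory D C T1 T2 T3"
  unfolding full_subcategory_def
  using assms two_complete_lattices.bij_betw_identify
  by (auto simp: is_context_complete_context identify_id identify_comp two_complete_lattices_iff
      dest: complete_context_eqD)


section \<open>The concept lattice as a reflection\<close>

lemma concept_le_iff:
  assumes "c \<in> concepts K" "d \<in> concepts K"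
  shows "fst c \<subseteq> fst d \<longleftrightarrow> snd d \<subseteq> snd c"
  using assms conceptsD[of "fst c" "snd c" K] conceptsD[of "fst d" "snd d" K]
  by (metis prod.collapse up_antimono down_antimono)

lemma concept_eqI:
  assumes "c \<in> concepts K" "d \<in> concepts K" "fst c = fst d"
  shows "c = d"
  using assms conceptsD(2)[of "fst c" "snd c" K] conceptsD(2)[of "fst d" "snd d" K]
  by (metis prod.collapse)

lemma carrier_concept_lattice [simp]: "carrier (concept_lattice K) = concepts K"
  by (simp add: concept_lattice_def)

lemma le_concept_lattice [simp]: "c \<sqsubseteq>\<^bsub>concept_lattice K\<^esub> d \<longleftrightarrow> fst c \<subseteq> fst d"
  by (simp add: concept_lattice_def)

lemma partial_order_concept_lattice: "partial_order (concept_lattice K)"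
  by unfold_locales (auto simp: concept_lattice_def dest: concept_eqI)

lemma complete_lattice_concept_lattice: "complete_lattice (concept_lattice K)"
proof -
  interpret partial_order "concept_lattice K"
    by (rule partial_order_concept_lattice)
  show ?thesis
  proof
    fix S assume S: "S \<subseteq> carrier (concept_lattice K)"
    \<comment> \<open>The intersection of the intents is the intent of the join; for empty S it
      consists of all attributes. Closing it once more in \<open>?c\<close> makes \<open>?c\<close>
      a concept by construction.\<close>
    let ?B = "{m \<in> attributes K. \<forall>c\<in>S. m \<in> snd c}"
    let ?c = "(down K ?B, up K (down K ?B))"
    have c: "?c \<in> concepts K"
      by (intro extent_concept down_in_extents) auto
    have *: "(\<forall>d\<in>S. fst d \<subseteq> fst e) \<longleftrightarrow> fst ?c \<subseteq> fst e" if e: "e \<in> concepts K" for e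
    proof -
      have "snd e \<subseteq> attributes K"
        using conceptsD(4)[of "fst e" "snd e"] e by simp
      have "(\<forall>d\<in>S. fst d \<subseteq> fst e) \<longleftrightarrow> (\<forall>d\<in>S. snd e \<subseteq> snd d)"
        using S e concept_le_iff by (metis carrier_concept_lattice subsetD)
      also have "\<dots> \<longleftrightarrow> snd e \<subseteq> ?B"
        using \<open>snd e \<subseteq> attributes K\<close> by auto
      also have "\<dots> \<longleftrightarrow> snd e \<subseteq> up K (down K ?B)"
      proof
        assume "snd e \<subseteq> ?B"
        then show "snd e \<subseteq> up K (down K ?B)"
          using subset_up_down[of ?B K] by auto
      next
        assume *: "snd e \<subseteq> up K (down K ?B)"
        \<comment> \<open>Each intent of the family contains \<open>?B\<close> and is closed, so it
          contains the closure of \<open>?B\<close>.\<close>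
        have "up K (down K ?B) \<subseteq> snd d" if "d \<in> S" for d
        proof -
          have d: "d \<in> concepts K"
            using that S by auto
          have "up K (down K ?B) \<subseteq> up K (down K (snd d))"
            using that by (intro up_antimono down_antimono) auto
          then show ?thesis
            using conceptsD(1,2)[of "fst d" "snd d" K] d by simp
        qed
        then show "snd e \<subseteq> ?B"
          using * \<open>snd e \<subseteq> attributes K\<close> by blast
      qed
      also have "\<dots> \<longleftrightarrow> fst ?c \<subseteq> fst e"
        using concept_le_iff[OF c e] by simp
      finally show ?thesis .
    qed
    have "Upper (concept_lattice K) S = {e \<in> concepts K. \<forall>d\<in>S. fst d \<subseteq> fst e}"
      using S by (fastforce simp: Upper_def)
    also have "\<dots> = {e \<in> concepts K. fst ?c \<subseteq> fst e}"
      using * by blast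
    finally show "\<exists>s. least (concept_lattice K) s (Upper (concept_lattice K) S)"
      using c by (intro exI[of _ ?c]) (simp add: least_def)
  next
    fix S assume S: "S \<subseteq> carrier (concept_lattice K)"
    \<comment> \<open>The intersection of the extents, all objects if S is empty, generates the
      meet.\<close>
    let ?A = "{g \<in> objects K. \<forall>c\<in>S. g \<in> fst c}"
    let ?c = "(down K (up K ?A), up K ?A)"
    have c: "?c \<in> concepts K"
      by (intro intent_concept up_in_intents) auto
    have "fst e \<subseteq> fst ?c" if "e \<in> concepts K" "\<forall>d\<in>S. fst e \<subseteq> fst d" for e
    proof -
      have "fst e \<subseteq> ?A"
        using that conceptsD(3)[of "fst e" "snd e"] by auto
      also have "?A \<subseteq> fst ?c"
        using subset_down_up[of ?A K] by simp
      finally show ?thesis .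
    qed
    moreover have "fst ?c \<subseteq> fst d" if "d \<in> S" for d
    proof -
      have "d \<in> concepts K"
        using that S by auto
      then have "down K (up K (fst d)) = fst d"
        using conceptsD(1,2)[of "fst d" "snd d"] by simp
      moreover have "down K (up K ?A) \<subseteq> down K (up K (fst d))"
        using that by (intro up_antimono down_antimono) auto
      ultimately show ?thesis by simp
    qed
    moreover have "Lower (concept_lattice K) S = {e \<in> concepts K. \<forall>d\<in>S. fst e \<subseteq> fst d}"
      using S by (fastforce simp: Lower_def)
    ultimately show "\<exists>i. greatest (concept_lattice K) i (Lower (concept_lattice K) S)"
      using c by (intro exI[of _ ?c]) (simp add: greatest_def)
  qed
qed

lemma gorder_complete_lattice_concept_lattice: "gorder_complete_lattice (concept_lattice K)"
  by (simp add: gorder_complete_lattice_iff complete_lattice_concept_lattice)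

text \<open>The closure of {g} is the least extent containing g. This turns order comparisons with
  the canonical map into membership.\<close>

lemma object_concept_le_iff:
  assumes "g \<in> objects K" "c \<in> concepts K"
  shows "fst (fst (concept_unit K) g) \<subseteq> fst c \<longleftrightarrow> g \<in> fst c"
proof -
  have "{g} \<subseteq> down K (up K {g})"
    using assms by (intro subset_down_up) simp
  moreover have "down K (up K {g}) \<subseteq> fst c" if "g \<in> fst c"
    using that conceptsD(1,2)[of "fst c" "snd c" K] assms
    by (metis bot_least insert_subset prod.collapse up_antimono down_antimono)
  ultimately show ?thesis
    using assms by (auto simp: concept_unit_def)
qed

lemma le_attribute_concept_iff:
  assumes "m \<in> attributes K" "c \<in> concepts K"
  shows "fst c \<subseteq> fst (snd (concept_unit K) m) \<longleftrightarrow> m \<in> snd c"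
proof -
  have "fst c \<subseteq> objects K" "up K (fst c) = snd c"
    using conceptsD[of "fst c" "snd c" K] assms by simp_all
  then show ?thesis
    using assms by (auto simp: concept_unit_def down_def up_def)
qed

section \<open>The canonical map into the concept lattice\<close>

lemma concept_unit_in_mapping_pairs:
  "concept_unit K \<in> mapping_pairs K (complete_context (concept_lattice K))"
  by (auto simp: mapping_pairs_def concept_unit_def intro!: extent_concept down_in_extents
      intent_concept up_in_intents)

text \<open>A concept d lies above the object concepts of all g in the extent of c iff its extent
  contains each such g, that is, iff it lies above c.\<close>

lemma concept_eq_sup:
  assumes c: "c \<in> concepts K"
  shows "c = \<Squnion>\<^bsub>concept_lattice K\<^esub>(fst (concept_unit K) ` fst c)"
proof -
  interpret gorder_complete_lattice "concept_lattice K"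
    by (rule gorder_complete_lattice_concept_lattice)
  have A: "fst c \<subseteq> objects K"
    using conceptsD[of "fst c" "snd c" K] c by simp
  then have sub: "fst (concept_unit K) ` fst c \<subseteq> carrier (concept_lattice K)"
    using concept_unit_in_mapping_pairs[of K] by (auto simp: mapping_pairs_def)
  show ?thesis
  proof (rule eqI_above)
    fix d assume d: "d \<in> carrier (concept_lattice K)"
    have "\<Squnion>\<^bsub>concept_lattice K\<^esub>(fst (concept_unit K) ` fst c) \<sqsubseteq>\<^bsub>concept_lattice K\<^esub> d \<longleftrightarrow>
        (\<forall>g\<in>fst c. g \<in> fst d)"
      using sup_le_iff[OF sub d] A d object_concept_le_iff[of _ K d] by (auto simp: subset_iff)
    then show "c \<sqsubseteq>\<^bsub>concept_lattice K\<^esub> d \<longleftrightarrow>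
        \<Squnion>\<^bsub>concept_lattice K\<^esub>(fst (concept_unit K) ` fst c) \<sqsubseteq>\<^bsub>concept_lattice K\<^esub> d"
      by (simp add: subset_eq)
  qed (use c sup_closed[OF sub] in simp_all)
qed

lemma concept_eq_inf:
  assumes c: "c \<in> concepts K"
  shows "c = \<Sqinter>\<^bsub>concept_lattice K\<^esub>(snd (concept_unit K) ` snd c)"
proof -
  interpret gorder_complete_lattice "concept_lattice K"
    by (rule gorder_complete_lattice_concept_lattice)
  have B: "snd c \<subseteq> attributes K"
    using conceptsD[of "fst c" "snd c" K] c by simp
  then have sub: "snd (concept_unit K) ` snd c \<subseteq> carrier (concept_lattice K)"
    using concept_unit_in_mapping_pairs[of K] by (auto simp: mapping_pairs_def)
  show ?thesis
  proof (rule eqI_below)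
    fix d assume d: "d \<in> carrier (concept_lattice K)"
    have "d \<sqsubseteq>\<^bsub>concept_lattice K\<^esub> \<Sqinter>\<^bsub>concept_lattice K\<^esub>(snd (concept_unit K) ` snd c) \<longleftrightarrow>
        (\<forall>m\<in>snd c. m \<in> snd d)"
      using le_inf_iff[OF sub d] B d le_attribute_concept_iff[of _ K d] by (auto simp: subset_iff)
    then show "d \<sqsubseteq>\<^bsub>concept_lattice K\<^esub> c \<longleftrightarrow>
        d \<sqsubseteq>\<^bsub>concept_lattice K\<^esub> \<Sqinter>\<^bsub>concept_lattice K\<^esub>(snd (concept_unit K) ` snd c)"
      using concept_le_iff[of d K c] c d by (simp add: subset_eq)
  qed (use c inf_closed[OF sub] in simp_all)
qed

lemma concept_unit_in_context_hom:
  "concept_unit K \<in> context_hom C K (complete_context (concept_lattice K))"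
proof -
  interpret gorder_complete_lattice "concept_lattice K"
    by (rule gorder_complete_lattice_concept_lattice)
  obtain \<gamma> \<mu> where e: "concept_unit K = (\<gamma>, \<mu>)"
    by (cases "concept_unit K")
  let ?R = "concept_lattice K"
  have map: "(\<gamma>, \<mu>) \<in> mapping_pairs K (complete_context ?R)"
    using concept_unit_in_mapping_pairs[of K] by (simp add: e)
  then have sub: "A \<subseteq> objects K \<Longrightarrow> \<gamma> ` A \<subseteq> carrier ?R"
    "B \<subseteq> attributes K \<Longrightarrow> \<mu> ` B \<subseteq> carrier ?R" for A B
    unfolding mapping_pairs_iff by auto
  have \<gamma>: "\<gamma> g \<sqsubseteq>\<^bsub>?R\<^esub> c \<longleftrightarrow> g \<in> fst c" if "g \<in> objects K" "c \<in> concepts K" for g c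
    using object_concept_le_iff[OF that] by (simp add: e)
  have \<mu>: "c \<sqsubseteq>\<^bsub>?R\<^esub> \<mu> m \<longleftrightarrow> m \<in> snd c" if "m \<in> attributes K" "c \<in> concepts K" for m c
    using le_attribute_concept_iff[OF that] by (simp add: e)
  have cc: "concept_continuous K (complete_context ?R) (\<gamma>, \<mu>)"
    unfolding concept_continuous_complete_context_iff[OF map]
  proof
    fix c assume "c \<in> carrier ?R"
    then have c: "c \<in> concepts K" "fst c \<subseteq> objects K" "snd c \<subseteq> attributes K"
      using conceptsD[of "fst c" "snd c" K] by simp_all
    \<comment> \<open>The preimages of the ideal and the filter of c are the extent and the intent
      of c.\<close>
    then have "{g \<in> objects K. \<gamma> g \<sqsubseteq>\<^bsub>?R\<^esub> c} = fst c" "{m \<in> attributes K. c \<sqsubseteq>\<^bsub>?R\<^esub> \<mu> m} = snd c"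
      using \<gamma>[OF _ c(1)] \<mu>[OF _ c(1)] by blast+
    then show "({g \<in> objects K. \<gamma> g \<sqsubseteq>\<^bsub>?R\<^esub> c}, {m \<in> attributes K. c \<sqsubseteq>\<^bsub>?R\<^esub> \<mu> m}) \<in> concepts K"
      using c by simp
  qed
  then have sc: "separately_continuous K (complete_context ?R) (\<gamma>, \<mu>)"
    by (rule concept_continuous_imp_separately_continuous)
  have conceptual: "conceptual K (complete_context ?R) (\<gamma>, \<mu>)"
    unfolding conceptual_def split_conv
  proof (intro conjI sc ballI)
    fix c assume c: "c \<in> concepts K"
    obtain A B where AB: "c = (A, B)"
      by (cases c)
    then have "A \<subseteq> objects K" "B \<subseteq> attributes K"
      using c conceptsD[of A B K] by simp_all
    \<comment> \<open>Both sides are the concept c itself, being the join of its object concepts and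
      the meet of its attribute concepts.\<close>
    moreover have "\<Squnion>\<^bsub>?R\<^esub>(\<gamma> ` A) = \<Sqinter>\<^bsub>?R\<^esub>(\<mu> ` B)"
      using concept_eq_sup[OF c] concept_eq_inf[OF c] unfolding AB e by (metis fst_conv snd_conv)
    ultimately show "case c of (A, B) \<Rightarrow>
        (down (complete_context ?R) (\<mu> ` B), up (complete_context ?R) (\<gamma> ` A))
        \<in> concepts (complete_context ?R)"
      unfolding AB split_conv
      using down_up_in_concepts_iff[OF sub] by blast
  qed
  have emb: "embedding K (complete_context ?R) (\<gamma>, \<mu>)"
    unfolding embedding_def split_conv
  proof (intro ballI)
    fix g m assume gm: "g \<in> objects K" "m \<in> attributes K"
    \<comment> \<open>As \<open>up K {g}\<close> is the intent of \<gamma> g, incidence of g and m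
      says that m belongs to this intent, which is \<gamma> g \<le> \<mu> m.\<close>
    have "\<gamma> g \<in> concepts K" "\<mu> m \<in> concepts K" "snd (\<gamma> g) = up K {g}"
      using gm map e by (auto simp: mapping_pairs_iff concept_unit_def)
    then show "(g, m) \<in> incidence K \<longleftrightarrow> (\<gamma> g, \<mu> m) \<in> incidence (complete_context ?R)"
      using \<mu>[of m "\<gamma> g"] gm by (simp add: up_def)
  qed
  have "\<exists>A\<subseteq>objects K. down (complete_context ?R) (up (complete_context ?R) C) =
      down (complete_context ?R) (up (complete_context ?R) (\<gamma> ` A))"
    if C: "C \<subseteq> carrier ?R" for C
  proof -
    \<comment> \<open>Polars in a complete context depend on the join only, so C may be exchanged
      for the object concepts of the extent of its join.\<close>
    let ?c = "\<Squnion>\<^bsub>?R\<^esub>C"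
    have c: "?c \<in> concepts K"
      using C sup_closed by simp
    then have "fst ?c \<subseteq> objects K"
      using conceptsD[of "fst ?c" "snd ?c" K] by simp
    moreover have "?c = \<Squnion>\<^bsub>?R\<^esub>(\<gamma> ` fst ?c)"
      using concept_eq_sup[OF c] by (simp add: e)
    ultimately show ?thesis
      using C sub(1) by (metis up_complete_context)
  qed
  moreover have "\<exists>B\<subseteq>attributes K. up (complete_context ?R) (down (complete_context ?R) D) =
      up (complete_context ?R) (down (complete_context ?R) (\<mu> ` B))"
    if D: "D \<subseteq> carrier ?R" for D
  proof -
    let ?c = "\<Sqinter>\<^bsub>?R\<^esub>D"
    have c: "?c \<in> concepts K"
      using D inf_closed by simp
    then have "snd ?c \<subseteq> attributes K"
      using conceptsD[of "fst ?c" "snd ?c" K] by simp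
    moreover have "?c = \<Sqinter>\<^bsub>?R\<^esub>(\<mu> ` snd ?c)"
      using concept_eq_inf[OF c] by (simp add: e)
    ultimately show ?thesis
      using D sub(2) by (metis down_complete_context)
  qed
  ultimately have dense: "dense_pair K (complete_context ?R) (\<gamma>, \<mu>)"
    by (simp add: dense_pair_def)
  show ?thesis
    using map sc cc conceptual emb dense by (cases C) (simp_all add: e context_hom_def)
qed

text \<open>An image under the composite is an image under the outer map. Since the given morphism
  is its extension composed with the canonical map, its density passes to the extension.\<close>

lemma dense_pair_comp_cancel:
  assumes p: "p \<in> mapping_pairs K L" and d: "dense_pair K M (pair_comp K q p)"
  shows "dense_pair L M q"
proof -
  obtain \<alpha> \<beta> \<gamma> \<delta> where [simp]: "p = (\<alpha>, \<beta>)" "q = (\<gamma>, \<delta>)"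
    by (cases p; cases q)
  have sub: "A \<subseteq> objects K \<Longrightarrow> \<alpha> ` A \<subseteq> objects L"
    "B \<subseteq> attributes K \<Longrightarrow> \<beta> ` B \<subseteq> attributes L" for A B
    using p unfolding \<open>p = (\<alpha>, \<beta>)\<close> mapping_pairs_iff by auto
  note d = dense_pairD[OF d[unfolded pair_comp_def]]
  show ?thesis
    unfolding dense_pair_def \<open>q = (\<gamma>, \<delta>)\<close> split_conv
  proof (intro conjI allI impI)
    fix C assume "C \<subseteq> objects M"
    then obtain A where "A \<subseteq> objects K" "down M (up M C) = down M (up M (\<gamma> ` \<alpha> ` A))"
      using d(1)[of C] by (auto simp: image_compose)
    then show "\<exists>A\<subseteq>objects L. down M (up M C) = down M (up M (\<gamma> ` A))"
      using sub(1) by blast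
  next
    fix D assume "D \<subseteq> attributes M"
    then obtain B where "B \<subseteq> attributes K" "up M (down M D) = up M (down M (\<delta> ` \<beta> ` B))"
      using d(2)[of D] by (auto simp: image_compose)
    then show "\<exists>B\<subseteq>attributes L. up M (down M D) = up M (down M (\<delta> ` B))"
      using sub(2) by blast
  qed
qed

lemma extend_along_concept_unit:
  fixes L :: "'x gorder"
  assumes L: "complete_lattice L" and p: "p \<in> context_hom C K (complete_context L)"
  shows "\<exists>q\<in>context_hom C (complete_context (concept_lattice K)) (complete_context L).
    pair_comp K q (concept_unit K) = p"
proof -
  let ?R = "concept_lattice K"
  interpret two_complete_lattices ?R L
    using L complete_lattice_concept_lattice by (auto simp: two_complete_lattices_iff)
  obtain \<alpha> \<beta> where p_eq: "p = (\<alpha>, \<beta>)"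
    by (cases p)
  have map: "(\<alpha>, \<beta>) \<in> mapping_pairs K cc'"
    using context_hom_imp_mapping_pairs[OF p] by (simp add: p_eq)
  then have sub: "A \<subseteq> objects K \<Longrightarrow> \<alpha> ` A \<subseteq> carrier L"
    "B \<subseteq> attributes K \<Longrightarrow> \<beta> ` B \<subseteq> carrier L" for A B
    unfolding mapping_pairs_iff by auto
  define f where "f = (\<lambda>c\<in>concepts K. \<Squnion>\<^bsub>L\<^esub>(\<alpha> ` fst c))"
  define f' where "f' = (\<lambda>c\<in>concepts K. \<Sqinter>\<^bsub>L\<^esub>(\<beta> ` snd c))"
  \<comment> \<open>\<open>X y\<close> and \<open>Y y\<close> are the preimages of the ideal and the
    filter of y, hence an extent and an intent. Bounds on f and f' become inclusions in these
    sets.\<close>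
  define X where "X y = {g \<in> objects K. \<alpha> g \<sqsubseteq>\<^bsub>L\<^esub> y}" for y
  define Y where "Y y = {m \<in> attributes K. y \<sqsubseteq>\<^bsub>L\<^esub> \<beta> m}" for y
  have concept_sub: "fst c \<subseteq> objects K" "snd c \<subseteq> attributes K" if "c \<in> concepts K" for c
    using conceptsD[of "fst c" "snd c" K] that by simp_all
  have f_le: "f c \<sqsubseteq>\<^bsub>L\<^esub> y \<longleftrightarrow> fst c \<subseteq> X y" if "c \<in> concepts K" "y \<in> carrier L" for c y
    using that sub(1)[of "fst c"] concept_sub[OF that(1)]
    by (auto simp: f_def X_def L'.sup_le_iff)
  have le_f': "y \<sqsubseteq>\<^bsub>L\<^esub> f' c \<longleftrightarrow> snd c \<subseteq> Y y" if "c \<in> concepts K" "y \<in> carrier L" for c y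
    using that sub(2)[of "snd c"] concept_sub[OF that(1)]
    by (auto simp: f'_def Y_def L'.le_inf_iff)
  have typed: "f \<in> carrier ?R \<rightarrow>\<^sub>E carrier L" "f' \<in> carrier ?R \<rightarrow>\<^sub>E carrier L"
    using L'.sup_closed[OF sub(1)[OF concept_sub(1)]] L'.inf_closed[OF sub(2)[OF concept_sub(2)]]
    unfolding f_def f'_def carrier_concept_lattice by (simp_all add: PiE_iff)
  have XY: "X y \<in> extents K" "Y y \<in> intents K" if "y \<in> carrier L" for y
    using context_hom_imp_separately_continuous[OF p] that
    unfolding p_eq L'.separately_continuous_complete_context_iff[OF map] X_def Y_def by simp_all
  \<comment> \<open>The preimages under f and f' are principal, generated by the concept with extent
    \<open>X y\<close> and by the one with intent \<open>Y y\<close>; these two may differ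
    here.\<close>
  have "{c \<in> carrier ?R. f c \<sqsubseteq>\<^bsub>L\<^esub> y} = down_set ?R (X y, up K (X y))"
    "{c \<in> carrier ?R. y \<sqsubseteq>\<^bsub>L\<^esub> f' c} = up_set ?R (down K (Y y), Y y)" if y: "y \<in> carrier L" for y
    using y f_le[OF _ y] le_f'[OF _ y] concept_le_iff[OF intent_concept[OF XY(2)[OF y]]]
    by (simp_all add: down_set_def up_set_def cong: conj_cong)
  then have sc: "separately_continuous cc cc' (f, f')"
    unfolding L'.separately_continuous_complete_context_iff[OF mapping_pair[OF typed]]
      L.extents_complete_context L.intents_complete_context
    using extent_concept[OF XY(1)] intent_concept[OF XY(2)] by auto
  have conceptual: "conceptual cc cc' (f, f')" if "conceptual K cc' p"
  proof -
    have "f' c = f c" if c: "c \<in> concepts K" for c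
    proof -
      \<comment> \<open>Over a complete lattice this says that the join of the \<alpha>-images
        equals the meet of the \<beta>-images, which are f c and f' c.\<close>
      have "(down cc' (\<beta> ` snd c), up cc' (\<alpha> ` fst c)) \<in> concepts cc'"
        using \<open>conceptual K cc' p\<close> c by (auto simp: conceptual_def p_eq)
      then show ?thesis
        using c sub concept_sub by (simp add: L'.down_up_in_concepts_iff f_def f'_def)
    qed
    then have "f' = f"
      using typed by (metis PiE_ext carrier_concept_lattice)
    then show ?thesis
      using sc unfolding conceptual_iff[OF typed] separately_continuous_iff[OF typed]
        complete_hom_def by simp
  qed
  have concept_continuous: "concept_continuous cc cc' (f, f')" if "concept_continuous K cc' p"
    unfolding L'.concept_continuous_complete_context_iff[OF mapping_pair[OF typed]]
  proof
    fix y assume y: "y \<in> carrier L"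
    then have XY: "(X y, Y y) \<in> concepts K"
      using that unfolding p_eq L'.concept_continuous_complete_context_iff[OF map] X_def Y_def
      by simp
    \<comment> \<open>Now \<open>X y\<close> and \<open>Y y\<close> form a single concept, which
      generates both the ideal and the filter.\<close>
    have "{c \<in> carrier ?R. f c \<sqsubseteq>\<^bsub>L\<^esub> y} = down_set ?R (X y, Y y)"
      "{c \<in> carrier ?R. y \<sqsubseteq>\<^bsub>L\<^esub> f' c} = up_set ?R (X y, Y y)"
      using f_le[OF _ y] le_f'[OF _ y] concept_le_iff[OF XY]
      by (simp_all add: down_set_def up_set_def cong: conj_cong)
    then show "({c \<in> objects cc. f c \<sqsubseteq>\<^bsub>L\<^esub> y}, {c \<in> attributes cc. y \<sqsubseteq>\<^bsub>L\<^esub> f' c}) \<in> concepts cc"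
      using XY by (auto simp: L.concepts_complete_context)
  qed
  have embedding: "embedding cc cc' (f, f')" if "embedding K cc' p"
  proof -
    have "fst c \<subseteq> fst d \<longleftrightarrow> f c \<sqsubseteq>\<^bsub>L\<^esub> f' d" if cd: "c \<in> concepts K" "d \<in> concepts K" for c d
    proof -
      have d: "fst d = down K (snd d)" "f' d \<in> carrier L"
        using cd conceptsD(1)[of "fst d" "snd d" K] typed by auto
      \<comment> \<open>The inequality between a join and a meet breaks up into \<alpha> g \<le>
        \<beta> m for all g in the extent of c and m in the intent of d. As incidences in K they say
        that the extent of c lies in that of d.\<close>
      have "f c \<sqsubseteq>\<^bsub>L\<^esub> f' d \<longleftrightarrow> (\<forall>g\<in>fst c. \<alpha> g \<sqsubseteq>\<^bsub>L\<^esub> f' d)"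
        using f_le[OF cd(1) d(2)] concept_sub[OF cd(1)] by (auto simp: X_def)
      also have "\<dots> \<longleftrightarrow> (\<forall>g\<in>fst c. snd d \<subseteq> Y (\<alpha> g))"
        using le_f'[OF cd(2)] concept_sub(1)[OF cd(1)] sub(1)[of "fst c"]
        by (simp add: image_subset_iff)
      also have "\<dots> \<longleftrightarrow> (\<forall>g\<in>fst c. \<forall>m\<in>snd d. \<alpha> g \<sqsubseteq>\<^bsub>L\<^esub> \<beta> m)"
        using concept_sub(2)[OF cd(2)] by (auto simp: Y_def)
      also have "\<dots> \<longleftrightarrow> (\<forall>g\<in>fst c. \<forall>m\<in>snd d. (g, m) \<in> incidence K)"
      proof (intro ball_cong refl)
        fix g m assume "g \<in> fst c" "m \<in> snd d"
        then have gm: "g \<in> objects K" "m \<in> attributes K"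
          using concept_sub(1)[OF cd(1)] concept_sub(2)[OF cd(2)] by auto
        then have "\<alpha> g \<in> carrier L" "\<beta> m \<in> carrier L"
          using map by (auto simp: mapping_pairs_iff)
        then show "\<alpha> g \<sqsubseteq>\<^bsub>L\<^esub> \<beta> m \<longleftrightarrow> (g, m) \<in> incidence K"
          using \<open>embedding K cc' p\<close> gm by (simp add: p_eq embedding_def)
      qed
      also have "\<dots> \<longleftrightarrow> fst c \<subseteq> fst d"
        unfolding d(1) using concept_sub(1)[OF cd(1)] by (auto simp: down_def)
      finally show ?thesis by simp
    qed
    then show ?thesis
      by (simp add: embedding_iff[OF typed])
  qed
  have comp: "pair_comp K (f, f') (concept_unit K) = p"
  proof -
    have "f (fst (concept_unit K) g) = \<alpha> g" if g: "g \<in> objects K" for g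
    proof (rule L'.eqI_above)
      have "(down K (up K {g}), up K {g}) \<in> concepts K"
        using g by (intro intent_concept up_in_intents) simp
      then have c: "fst (concept_unit K) g \<in> concepts K"
        using g by (simp add: concept_unit_def)
      then show "f (fst (concept_unit K) g) \<in> carrier L" "\<alpha> g \<in> carrier L"
        using typed sub(1)[of "{g}"] g by auto
      fix y assume y: "y \<in> carrier L"
      \<comment> \<open>Since \<open>X y\<close> is an extent, it contains the extent of the object
        concept of g as soon as it contains g.\<close>
      show "f (fst (concept_unit K) g) \<sqsubseteq>\<^bsub>L\<^esub> y \<longleftrightarrow> \<alpha> g \<sqsubseteq>\<^bsub>L\<^esub> y"
        using f_le[OF c y] object_concept_le_iff[OF g extent_concept[OF XY(1)[OF y]]] g
        by (simp add: X_def)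
    qed
    moreover have "f' (snd (concept_unit K) m) = \<beta> m" if m: "m \<in> attributes K" for m
    proof (rule L'.eqI_below)
      have "(down K {m}, up K (down K {m})) \<in> concepts K"
        using m by (intro extent_concept down_in_extents) simp
      then have c: "snd (concept_unit K) m \<in> concepts K"
        using m by (simp add: concept_unit_def)
      then show "f' (snd (concept_unit K) m) \<in> carrier L" "\<beta> m \<in> carrier L"
        using typed sub(2)[of "{m}"] m by auto
      fix y assume y: "y \<in> carrier L"
      have "snd (snd (concept_unit K) m) \<subseteq> Y y \<longleftrightarrow> m \<in> Y y"
        using le_attribute_concept_iff[OF m intent_concept[OF XY(2)[OF y]]]
          concept_le_iff[OF intent_concept[OF XY(2)[OF y]] c] by simp
      then show "y \<sqsubseteq>\<^bsub>L\<^esub> f' (snd (concept_unit K) m) \<longleftrightarrow> y \<sqsubseteq>\<^bsub>L\<^esub> \<beta> m"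
        using le_f'[OF c y] m by (simp add: Y_def)
    qed
    ultimately show ?thesis
      using map unfolding p_eq pair_comp_def mapping_pairs_iff compose_def
      by (auto simp: PiE_iff extensional_def)
  qed
  moreover have "dense_pair cc cc' (f, f')" if "dense_pair K cc' p"
    using dense_pair_comp_cancel[OF concept_unit_in_mapping_pairs] that comp by metis
  then have "(f, f') \<in> context_hom C cc cc'"
    using p mapping_pair[OF typed] sc conceptual concept_continuous embedding
    by (cases C) (simp_all add: context_hom_def)
  ultimately show ?thesis
    by blast
qed

text \<open>A separately continuous r preserves joins in its first and meets in its second
  component, so it is determined by its values on object concepts and attribute concepts, which the
  composite with the canonical map records.\<close>

lemma extension_along_concept_unit_unique:
  fixes L :: "'x gorder"
  assumes L: "complete_lattice L"
    and q: "q \<in> context_hom C (complete_context (concept_lattice K)) (complete_context L)"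
    and q': "q' \<in> context_hom C (complete_context (concept_lattice K)) (complete_context L)"
    and eq: "pair_comp K q (concept_unit K) = pair_comp K q' (concept_unit K)"
  shows "q = q'"
proof -
  let ?R = "concept_lattice K"
  interpret two_complete_lattices ?R L
    using L complete_lattice_concept_lattice by (auto simp: two_complete_lattices_iff)
  have *: "fst r \<in> carrier ?R \<rightarrow>\<^sub>E carrier L" "snd r \<in> carrier ?R \<rightarrow>\<^sub>E carrier L"
    "c \<in> concepts K \<Longrightarrow> fst r c = \<Squnion>\<^bsub>L\<^esub>(fst (pair_comp K r (concept_unit K)) ` fst c)"
    "c \<in> concepts K \<Longrightarrow> snd r c = \<Sqinter>\<^bsub>L\<^esub>(snd (pair_comp K r (concept_unit K)) ` snd c)"
    if r: "r \<in> context_hom C cc cc'" for r c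
  proof -
    show typed: "fst r \<in> carrier ?R \<rightarrow>\<^sub>E carrier L" "snd r \<in> carrier ?R \<rightarrow>\<^sub>E carrier L"
      using context_hom_imp_mapping_pairs[OF r] mapping_pairs_cc_iff[of "fst r" "snd r"] by simp_all
    have pres: "sup_pres ?R L (fst r)" "inf_pres ?R L (snd r)"
      using context_hom_imp_separately_continuous[OF r] separately_continuous_iff[OF typed]
      by simp_all
    assume c: "c \<in> concepts K"
    then have sub: "fst c \<subseteq> objects K" "snd c \<subseteq> attributes K"
      using conceptsD[of "fst c" "snd c" K] by simp_all
    then have "fst (concept_unit K) ` fst c \<subseteq> carrier ?R" "snd (concept_unit K) ` snd c \<subseteq> carrier ?R"
      using concept_unit_in_mapping_pairs[of K] by (auto simp: mapping_pairs_def)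
    then have "fst r (\<Squnion>\<^bsub>?R\<^esub>(fst (concept_unit K) ` fst c)) =
        \<Squnion>\<^bsub>L\<^esub>(fst r ` fst (concept_unit K) ` fst c)"
      "snd r (\<Sqinter>\<^bsub>?R\<^esub>(snd (concept_unit K) ` snd c)) =
        \<Sqinter>\<^bsub>L\<^esub>(snd r ` snd (concept_unit K) ` snd c)"
      using pres unfolding sup_pres_def inf_pres_def by blast+
    then show "fst r c = \<Squnion>\<^bsub>L\<^esub>(fst (pair_comp K r (concept_unit K)) ` fst c)"
      "snd r c = \<Sqinter>\<^bsub>L\<^esub>(snd (pair_comp K r (concept_unit K)) ` snd c)"
      using concept_eq_sup[OF c] concept_eq_inf[OF c] sub by (simp_all add: pair_comp_def image_compose)
  qed
  have "fst q c = fst q' c" "snd q c = snd q' c" if "c \<in> concepts K" for c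
    using that by (simp_all add: *(3,4)[OF q] *(3,4)[OF q'] eq)
  then have "fst q = fst q'" "snd q = snd q'"
    using PiE_ext[OF *(1)[OF q] *(1)[OF q']] PiE_ext[OF *(2)[OF q] *(2)[OF q']] by simp_all
  then show ?thesis
    by (rule prod_eqI)
qed

text \<open>The extension q is found and shown unique among context morphisms; bijectivity of
  \<open>identify\<close> turns it into a unique lattice morphism h.\<close>

lemma reflective:
  assumes "(D, C) \<in> corresponding_cats"
  shows "reflective D C TK (TL :: 'x itself)"
  unfolding reflective_def is_reflection_def
proof (intro allI impI conjI ballI complete_lattice_concept_lattice concept_unit_in_context_hom)
  fix K :: "('a, 'b) formal_context" and L :: "'x gorder" and p
  assume L: "complete_lattice L" and p: "p \<in> context_hom C K (complete_context L)"
  let ?R = "concept_lattice K"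
  interpret two_complete_lattices ?R L
    using L complete_lattice_concept_lattice by (auto simp: two_complete_lattices_iff)
  have bij: "bij_betw (identify D ?R L) (lattice_hom D ?R L) (context_hom C cc cc')"
    using assms by (rule bij_betw_identify)
  obtain q where q: "q \<in> context_hom C cc cc'" "pair_comp K q (concept_unit K) = p"
    using extend_along_concept_unit[OF L p] by blast
  then obtain h where h: "h \<in> lattice_hom D ?R L" "identify D ?R L h = q"
    using bij by (metis bij_betw_def imageE)
  show "\<exists>!h. h \<in> lattice_hom D ?R L \<and> pair_comp K (identify D ?R L h) (concept_unit K) = p"
  proof (rule ex1I[of _ h])
    show "h \<in> lattice_hom D ?R L \<and> pair_comp K (identify D ?R L h) (concept_unit K) = p"
      using h q by simp
    fix k assume k: "k \<in> lattice_hom D ?R L \<and> pair_comp K (identify D ?R L k) (concept_unit K) = p"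
    then have "identify D ?R L k \<in> context_hom C cc cc'"
      using bij by (auto simp: bij_betw_def)
    then have "identify D ?R L k = identify D ?R L h"
      using extension_along_concept_unit_unique[OF L _ q(1)] k q(2) h(2) by simp
    then show "k = h"
      using bij h(1) k by (auto simp: bij_betw_def dest: inj_onD)
  qed
qed

theorem corollary5p2:
  shows "\<forall>(D, C) \<in>
      {(CLjm, Cjm), (CLc, Cc), (CLcd, Ccd), (CLce, Cce), (CLis, Cde),
       (CLc_low, Ccc), (CLc_low_d, Cccd), (CLc_low_e, Ccce),
       (CLc_upp, Ccc), (CLc_upp_d, Cccd), (CLc_upp_e, Ccce)}.
    context_category C
      TYPE(('g1, 'm1) formal_context) TYPE(('g2, 'm2) formal_context)
      TYPE(('g3, 'm3) formal_context) TYPE(('g4, 'm4) formal_context) \<and>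
    lattice_category D TYPE('x1) TYPE('x2) TYPE('x3) TYPE('x4) \<and>
    full_subcategory D C TYPE('x1) TYPE('x2) TYPE('x3) \<and>
    reflective D C TYPE(('g1, 'm1) formal_context) TYPE('x1)"
  unfolding corresponding_cats_def[symmetric]
  using context_category lattice_category full_subcategory reflective by fast

end
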